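(* Let $X$ be a real Banach space and $f:X\to\mathbb R$ a locally Lipschitz functional. Assume that $X$ admits a decomposition $X=X_1\oplus X_2$, where $X_2$ is a finite dimensional subspace of $X$. For some fixed $z\in X_2$, suppose that there exists $R>\|z\|$ such that $$\inf_{x\in X_1}f(x+z)>\max_{x\in K^*}f(x),\qquad\text{where } K^*=\{x\in X_2:\ \|x\|=R\}.$$ Set $$K=\{x\in X_2:\ \|x\|\le R\},\qquad \mathcal P=\{p\in C(K,X):\ p(x)=x\ \text{ if }\|x\|=R\},$$ $$c=\inf_{p\in\mathcal P}\max_{x\in K}f(p(x)).$$ If $f$ satisfies the condition $(\mathrm{PS})_c$, then $c$ is a critical value of $f$.
   Context: The generalized directional derivative is $f^0(x,v)=\limsup_{y\to x,\ \mu\searrow0}\frac{f(y+\mu v)-f(y)}{\mu}$; the Clarke generalized gradient is $\partial f(x)=\{x^*\in X^*:\ f^0(x,v)\ge\langle x^*,v\rangle\ \text{for all }v\in X\}$; and $\lambda(x)=\min_{x^*\in\partial f(x)}\|x^*\|$. A point $x$ is critical if $0\in\partial f(x)$; $c$ is a critical value if $f(x)=c$ for some critical point $x$. $f$ satisfies $(\mathrm{PS})_c$ if every sequence $(x_n)$ in $X$ with $f(x_n)\to c$ and $\lambda(x_n)\to0$ contains a convergent subsequence. *)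

theory Defs
  imports "HOL-Analysis.Analysis"
begin

definition locally_lipschitz :: "('a::metric_space \<Rightarrow> 'b::metric_space) \<Rightarrow> bool" where
  "locally_lipschitz f \<longleftrightarrow> (\<forall>x. \<exists>r>0. \<exists>L. L-lipschitz_on (ball x r) f)"

text \<open>
  The Clarke directional derivative is taken in the extended reals, where the limit superior of an
  arbitrary function makes sense; it is finite for locally Lipschitz functions. The base
  point \<open>y\<close> ranges over full neighbourhoods of \<open>x\<close>, so \<open>y = x\<close> is allowed.
\<close>

definition clarke_dderiv :: "('a::real_normed_vector \<Rightarrow> real) \<Rightarrow> 'a \<Rightarrow> 'a \<Rightarrow> ereal" where
  "clarke_dderiv f x v =
     Limsup (nhds x \<times>\<^sub>F at_right 0) (\<lambda>(y, \<mu>). ereal ((f (y + \<mu> *\<^sub>R v) - f y) / \<mu>))"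

definition clarke_gradient ::
    "('a::real_normed_vector \<Rightarrow> real) \<Rightarrow> 'a \<Rightarrow> ('a \<Rightarrow>\<^sub>L real) set" where
  "clarke_gradient f x = {\<xi>. \<forall>v. clarke_dderiv f x v \<ge> ereal (blinfun_apply \<xi> v)}"

text \<open>
  For locally Lipschitz \<open>f\<close> the Clarke gradient is nonempty and weak-star compact, so the infimum
  below is a minimum. The norm is the operator norm of the dual space.
\<close>

definition min_slope :: "('a::real_normed_vector \<Rightarrow> real) \<Rightarrow> 'a \<Rightarrow> real" where
  "min_slope f x = (INF \<xi>\<in>clarke_gradient f x. norm \<xi>)"

definition critical_point :: "('a::real_normed_vector \<Rightarrow> real) \<Rightarrow> 'a \<Rightarrow> bool" where
  "critical_point f x \<longleftrightarrow> 0 \<in> clarke_gradient f x"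

definition critical_value :: "('a::real_normed_vector \<Rightarrow> real) \<Rightarrow> real \<Rightarrow> bool" where
  "critical_value f c \<longleftrightarrow> (\<exists>x. critical_point f x \<and> f x = c)"

definition palais_smale :: "('a::real_normed_vector \<Rightarrow> real) \<Rightarrow> real \<Rightarrow> bool" where
  "palais_smale f c \<longleftrightarrow>
     (\<forall>x :: nat \<Rightarrow> 'a. (\<lambda>n. f (x n)) \<longlonglongrightarrow> c \<longrightarrow> (\<lambda>n. min_slope f (x n)) \<longlonglongrightarrow> 0 \<longrightarrow>
        (\<exists>r l. strict_mono (r :: nat \<Rightarrow> nat) \<and> (x \<circ> r) \<longlonglongrightarrow> l))"

definition direct_sum_decomposition :: "'a::real_vector set \<Rightarrow> 'a set \<Rightarrow> bool" where
  "direct_sum_decomposition X1 X2 \<longleftrightarrow>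
     subspace X1 \<and> subspace X2 \<and> X1 \<inter> X2 = {0} \<and> (\<forall>x. \<exists>x1\<in>X1. \<exists>x2\<in>X2. x = x1 + x2)"

text \<open>The library's \<open>dim\<close> is \<open>0\<close> on infinite-dimensional sets and so cannot express this.\<close>

definition finite_dimensional_subspace :: "'a::real_vector set \<Rightarrow> bool" where
  "finite_dimensional_subspace S \<longleftrightarrow> (\<exists>B. finite B \<and> S = span B)"

text \<open>
  Elements of \<open>C(K, X)\<close> are represented by total functions; only their values on \<open>K\<close> matter.
\<close>

definition fixed_sphere_maps :: "'a::real_normed_vector set \<Rightarrow> real \<Rightarrow> ('a \<Rightarrow> 'a) set" where
  "fixed_sphere_maps K R = {p. continuous_on K p \<and> (\<forall>x\<in>K. norm x = R \<longrightarrow> p x = x)}"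

end

theory Submission
  imports Defs "HOL-Homology.Brouwer_Degree"
begin

text \<open>
  The space \<open>X\<^sub>1\<close> is not assumed closed, but the hypothesis on levels forces
  \<open>closure X\<^sub>1 \<inter> X\<^sub>2 = {0}\<close>: otherwise a line through \<open>z\<close> inside \<open>closure X\<^sub>1 + z\<close> would meet the sphere
  \<open>K\<^sup>*\<close>. Hence the projection onto \<open>X\<^sub>2\<close> along \<open>X\<^sub>1\<close> is continuous, and non-contractibility of spheres
  shows that every admissible map meets \<open>X\<^sub>1 + z\<close>, so that \<open>c\<close> lies above the values of \<open>f\<close> on \<open>K\<^sup>*\<close>.

  Composing with a retraction onto \<open>K\<close> turns the admissible maps into a closed subset of a space of bounded
  continuous functions, where Ekeland's principle gives almost minimizers \<open>g\<close> of \<open>max f \<circ> g\<close>. If the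
  Clarke gradient had no small element at any maximum point of \<open>f \<circ> g\<close>, the Hahn-Banach theorem would
  give local descent directions there, and moving \<open>g\<close> along a combination of them
  by a partition of unity would decrease the maximum too fast. The almost critical points
  so obtained form a Palais-Smale sequence at level \<open>c\<close>.
\<close>

subsection \<open>The variational principle of Ekeland\<close>

text \<open>\<open>T x\<close> collects the points that beat \<open>x\<close> after paying
  \<open>\<epsilon>\<close> per unit of distance; this relation is transitive. Choosing each
  \<open>s (Suc n)\<close> in \<open>T (s n)\<close> with nearly least \<open>F\<close> makes the
  nested sets \<open>T (s n)\<close> shrink to a single point \<open>l\<close>, and no other point
  beats \<open>l\<close>. Lower semicontinuity enters as sequential closedness of sublevel
  sets.\<close>

lemma ekeland:
  fixes F :: "'a::metric_space \<Rightarrow> real"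
  assumes S: "complete S" and x0: "x0 \<in> S" and bd: "\<And>x. x \<in> S \<Longrightarrow> m \<le> F x"
    and lsc: "\<And>s l b. (\<And>n. s n \<in> S) \<Longrightarrow> s \<longlonglongrightarrow> l \<Longrightarrow> (\<And>n. F (s n) \<le> b) \<Longrightarrow> F l \<le> b"
    and e: "\<epsilon> > 0"
  obtains x where "x \<in> S" "F x \<le> F x0" "\<And>y. y \<in> S \<Longrightarrow> F x \<le> F y + \<epsilon> * dist x y"
proof -
  define T where "T x = {y \<in> S. F y + \<epsilon> * dist x y \<le> F x}" for x
  define I where "I x = (INF y\<in>T x. F y)" for x
  have bdT: "bdd_below (F ` T x)" for x
    using bd by (auto simp: T_def intro!: bdd_belowI2)
  have selfT: "x \<in> T x" if "x \<in> S" for x using that by (simp add: T_def)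
  have TT: "w \<in> T x" if "y \<in> T x" "w \<in> T y" for x y w
  proof -
    have "\<epsilon> * dist x w \<le> \<epsilon> * dist x y + \<epsilon> * dist y w"
      using e by (simp add: distrib_left[symmetric] dist_triangle)
    then show ?thesis using that by (auto simp: T_def)
  qed
  have "\<exists>y\<in>T x. F y < I x + inverse (real (Suc n))" if "x \<in> S" for x n
  proof -
    have "(INF y\<in>T x. F y) < I x + inverse (real (Suc n))" by (simp add: I_def)
    then show ?thesis using cINF_less_iff[OF _ bdT[of x]] selfT[OF that] by blast
  qed
  then have step: "\<exists>y. y \<in> S \<and> (y \<in> T x \<and> F y < I x + inverse (real (Suc n)))" if "x \<in> S" for x n
    using that unfolding T_def by blast
  obtain s where s0: "s 0 = x0" and sS: "\<And>n. s n \<in> S"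
    and sT: "\<And>n. s (Suc n) \<in> T (s n)" and sI: "\<And>n. F (s (Suc n)) < I (s n) + inverse (real (Suc n))"
  proof -
    have "\<exists>s. \<forall>n. (s n \<in> S \<and> (n = 0 \<longrightarrow> s n = x0)) \<and>
       (s (Suc n) \<in> T (s n) \<and> F (s (Suc n)) < I (s n) + inverse (real (Suc n)))"
      by (rule dependent_nat_choice) (use x0 step in auto)
    then show ?thesis using that by blast
  qed
  have sT': "s k \<in> T (s n)" if "n \<le> k" for n k
    using that
  proof (induction rule: dec_induct)
    case base show ?case by (rule selfT[OF sS])
  next
    case (step k) then show ?case using TT sT by blast
  qed
  \<comment> \<open>Moving from \<open>s (Suc n)\<close> to \<open>y\<close> stays inside
    \<open>T (s n)\<close>, where \<open>F\<close> can drop by at most \<open>1 / (n + 1)\<close>,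
    and the drop has to pay for the distance.\<close>
  have small: "dist (s (Suc n)) y \<le> inverse (real (Suc n)) / \<epsilon>" if "y \<in> T (s (Suc n))" for y n
  proof -
    have "y \<in> T (s n)" using TT[OF sT that] .
    then have "I (s n) \<le> F y" unfolding I_def by (rule cINF_lower[OF bdT])
    moreover have "F y + \<epsilon> * dist (s (Suc n)) y \<le> F (s (Suc n))" using that by (simp add: T_def)
    ultimately have "\<epsilon> * dist (s (Suc n)) y \<le> inverse (real (Suc n))" using sI[of n] by linarith
    then show ?thesis using e by (simp add: pos_le_divide_eq mult.commute del: of_nat_Suc inverse_eq_divide)
  qed
  have lim0: "(\<lambda>n. inverse (real (Suc n)) / \<epsilon>) \<longlonglongrightarrow> 0"
    using tendsto_divide[OF LIMSEQ_inverse_real_of_nat tendsto_const[of \<epsilon>]] e by simp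
  have "Cauchy s"
  proof (rule metric_CauchyI)
    fix r :: real assume "r > 0"
    then obtain N where N: "inverse (real (Suc N)) / \<epsilon> < r / 2"
      using order_tendstoD(2)[OF lim0, of "r/2"] by (auto simp: eventually_sequentially)
    have "dist (s k) (s l) < r" if "k \<ge> Suc N" "l \<ge> Suc N" for k l
      using small[OF sT'[OF that(1)]] small[OF sT'[OF that(2)]] N
        dist_triangle3[of "s k" "s l" "s (Suc N)"] by linarith
    then show "\<exists>M. \<forall>k\<ge>M. \<forall>l\<ge>M. dist (s k) (s l) < r" by blast
  qed
  then obtain l where lS: "l \<in> S" and l: "s \<longlonglongrightarrow> l"
    using S sS unfolding complete_def by meson
  have lT: "l \<in> T (s n)" for n
  proof -
    \<comment> \<open>On a tail the distance penalty is within \<open>r\<close> of its limit, so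
      \<open>F\<close> has a constant upper bound there and \<open>lsc\<close> applies.\<close>
    have "F l \<le> F (s n) - \<epsilon> * dist (s n) l + r" if "r > 0" for r
    proof -
      have "(\<lambda>k. \<epsilon> * dist (s n) (s k)) \<longlonglongrightarrow> \<epsilon> * dist (s n) l"
        by (intro tendsto_intros l)
      then have "eventually (\<lambda>k. \<epsilon> * dist (s n) (s k) > \<epsilon> * dist (s n) l - r) sequentially"
        by (rule order_tendstoD) (use that in simp)
      then obtain M where M: "\<And>k. k \<ge> M \<Longrightarrow> \<epsilon> * dist (s n) (s k) > \<epsilon> * dist (s n) l - r"
        by (auto simp: eventually_sequentially)
      show ?thesis
      proof (rule lsc[of "\<lambda>k. s (k + max M n)"])
        show "(\<lambda>k. s (k + max M n)) \<longlonglongrightarrow> l" using l by (rule LIMSEQ_ignore_initial_segment)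
        fix k
        show "s (k + max M n) \<in> S" by (rule sS)
        have "s (k + max M n) \<in> T (s n)" by (rule sT') auto
        then show "F (s (k + max M n)) \<le> F (s n) - \<epsilon> * dist (s n) l + r"
          using M[of "k + max M n"] by (simp add: T_def max.coboundedI1 trans_le_add2)
      qed
    qed
    then have "F l \<le> F (s n) - \<epsilon> * dist (s n) l" by (rule field_le_epsilon)
    then show ?thesis using lS by (simp add: T_def)
  qed
  show ?thesis
  proof
    show "l \<in> S" by (rule lS)
    show "F l \<le> F x0"
    proof -
      have "F l + \<epsilon> * dist x0 l \<le> F x0" using lT[of 0] by (simp add: T_def s0)
      moreover have "0 \<le> \<epsilon> * dist x0 l" using e by simp
      ultimately show ?thesis by linarith
    qed
    fix y assume y: "y \<in> S"
    show "F l \<le> F y + \<epsilon> * dist l y"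
    \<comment> \<open>A point violating the inequality would lie in every \<open>T (s n)\<close>, so
      \<open>s\<close> would converge to it as well as to \<open>l\<close>.\<close>
    proof (rule ccontr)
      assume n: "\<not> ?thesis"
      then have "y \<in> T l" using y by (simp add: T_def)
      then have yT: "y \<in> T (s n)" for n using TT lT by blast
      have "(\<lambda>n. s (Suc n)) \<longlonglongrightarrow> y"
        unfolding tendsto_dist_iff[of _ y]
        by (rule tendsto_sandwich[OF _ _ tendsto_const lim0]) (auto intro!: small yT eventuallyI simp del: of_nat_Suc)
      then have "y = l" using LIMSEQ_unique LIMSEQ_Suc[OF l] by blast
      then show False using n by simp
    qed
  qed
qed

subsection \<open>Hahn-Banach and small elements of the Clarke gradient\<close>

text \<open>Homogeneity is asked only as an inequality for positive factors, the form in which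
  infima deliver it; applying it to the inverse factor restores equality.\<close>

definition sublinear :: "('a::real_vector \<Rightarrow> real) \<Rightarrow> bool" where
  "sublinear q \<longleftrightarrow> (\<forall>x y. q (x + y) \<le> q x + q y) \<and> (\<forall>t x. t > 0 \<longrightarrow> q (t *\<^sub>R x) \<le> t * q x)"

lemma sublinear_add: "sublinear q \<Longrightarrow> q (x + y) \<le> q x + q y"
  and sublinear_scale_le: "sublinear q \<Longrightarrow> t > 0 \<Longrightarrow> q (t *\<^sub>R x) \<le> t * q x"
  by (auto simp: sublinear_def)

lemma sublinear_zero: assumes "sublinear q" shows "q 0 = 0"
proof -
  have "q 0 \<le> (1/2) * q 0" using sublinear_scale_le[OF assms, of "1/2" 0] by simp
  moreover have "q 0 \<le> q 0 + q 0" using sublinear_add[OF assms, of 0 0] by simp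
  ultimately show ?thesis by simp
qed

lemma sublinear_scale: assumes "sublinear q" "t \<ge> 0" shows "q (t *\<^sub>R x) = t * q x"
proof (cases "t = 0")
  case True then show ?thesis by (simp add: sublinear_zero[OF assms(1)])
next
  case False
  then have t: "t > 0" using assms by simp
  have "q (inverse t *\<^sub>R (t *\<^sub>R x)) \<le> inverse t * q (t *\<^sub>R x)"
    by (rule sublinear_scale_le[OF assms(1)]) (use t in simp)
  then have "t * q x \<le> q (t *\<^sub>R x)" using t by (simp add: field_simps)
  then show ?thesis using sublinear_scale_le[OF assms(1) t, of x] by simp
qed

lemma sublinear_lower: assumes "sublinear q" shows "- q (- x) \<le> q x"
  using sublinear_add[OF assms, of x "- x"] sublinear_zero[OF assms] by simp

text \<open>A sublinear functional that is minimal in the pointwise order is linear, because the functional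
  \<open>x \<mapsto> inf\<^sub>t (p (x + t w) - t p w)\<close> below is sublinear and bounded by \<open>p\<close>.\<close>

lemma minimal_sublinear_linear:
  assumes p: "sublinear p" and min: "\<And>r. sublinear r \<Longrightarrow> (\<And>x. r x \<le> p x) \<Longrightarrow> r = p"
  shows "linear p"
proof -
  have add: "p x + p w \<le> p (x + w)" for x w
  proof -
    define r where "r v = (INF t\<in>{0..}. p (v + t *\<^sub>R w) - t * p w)" for v
    have lb: "- p (- v) \<le> p (v + t *\<^sub>R w) - t * p w" if "t \<ge> 0" for v t
      using sublinear_add[OF p, of "v + t *\<^sub>R w" "- v"] sublinear_scale[OF p that, of w] by simp
    have bdd: "bdd_below ((\<lambda>t. p (v + t *\<^sub>R w) - t * p w) ` {0..})" for v
      using lb by (auto intro!: bdd_belowI2)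
    have up: "r v \<le> p (v + t *\<^sub>R w) - t * p w" if "t \<ge> 0" for v t
      unfolding r_def by (rule cINF_lower[OF bdd]) (use that in simp)
    have "sublinear r"
      unfolding sublinear_def
    proof (intro conjI allI impI)
      fix x y
      have "r (x + y) - (p (y + t *\<^sub>R w) - t * p w) \<le> r x" if t: "t \<ge> 0" for t
        unfolding r_def[of x]
      proof (rule cINF_greatest)
        fix s :: real assume "s \<in> {0..}"
        then have s: "s \<ge> 0" by simp
        have "r (x + y) \<le> p (x + y + (s + t) *\<^sub>R w) - (s + t) * p w" by (rule up) (use s t in simp)
        also have "x + y + (s + t) *\<^sub>R w = (x + s *\<^sub>R w) + (y + t *\<^sub>R w)" by (simp add: algebra_simps)
        also have "p \<dots> \<le> p (x + s *\<^sub>R w) + p (y + t *\<^sub>R w)" by (rule sublinear_add[OF p])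
        finally show "r (x + y) - (p (y + t *\<^sub>R w) - t * p w) \<le> p (x + s *\<^sub>R w) - s * p w"
          by (simp add: algebra_simps)
      qed auto
      then have "r (x + y) - r x \<le> p (y + t *\<^sub>R w) - t * p w" if "t \<ge> 0" for t
        using that by (smt (verit))
      then have "r (x + y) - r x \<le> r y"
        unfolding r_def[of y] by (intro cINF_greatest) auto
      then show "r (x + y) \<le> r x + r y" by simp
    next
      fix t x assume t: "(t::real) > 0"
      have "r (t *\<^sub>R x) / t \<le> r x"
        unfolding r_def[of x]
      proof (rule cINF_greatest)
        fix s :: real assume "s \<in> {0..}"
        then have "r (t *\<^sub>R x) \<le> p (t *\<^sub>R x + (t * s) *\<^sub>R w) - (t * s) * p w" using t by (intro up) simp
        also have "t *\<^sub>R x + (t * s) *\<^sub>R w = t *\<^sub>R (x + s *\<^sub>R w)" by (simp add: algebra_simps)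
        also have "p \<dots> = t * p (x + s *\<^sub>R w)" using sublinear_scale[OF p] t by simp
        finally show "r (t *\<^sub>R x) / t \<le> p (x + s *\<^sub>R w) - s * p w" using t by (simp add: field_simps)
      qed auto
      then show "r (t *\<^sub>R x) \<le> t * r x" using t by (simp add: field_simps)
    qed
    moreover have "r v \<le> p v" for v using up[of 0 v] by simp
    \<comment> \<open>With \<open>r = p\<close>, the competitor \<open>t = 1\<close> in the infimum
      gives superadditivity of \<open>p\<close>.\<close>
    ultimately have "r = p" by (rule min)
    then show ?thesis using up[of 1 x] by simp
  qed
  then have add': "p (x + y) = p x + p y" for x y
    using sublinear_add[OF p, of x y] by (simp add: antisym)
  have neg: "p (- x) = - p x" for x using add'[of x "- x"] sublinear_zero[OF p] by simp
  show ?thesis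
  proof (rule linearI)
    fix t x
    show "p (t *\<^sub>R x) = t *\<^sub>R p x"
    proof (cases "t \<ge> 0")
      case True then show ?thesis using sublinear_scale[OF p] by simp
    next
      case False
      then show ?thesis using sublinear_scale[OF p, of "- t" x] neg[of "t *\<^sub>R x"] by simp
    qed
  qed (rule add')
qed

text \<open>Zorn's lemma, for the reversed pointwise order, yields a minimal sublinear functional
  below \<open>q\<close>, which is linear. The infimum of a chain is finite because
  \<open>- q (- x)\<close> bounds its members below, and it is subadditive because of any two
  members the smaller one serves both arguments.\<close>

lemma hahn_banach_sublinear:
  assumes q: "sublinear q"
  obtains p where "linear p" "\<And>x. p x \<le> q x"
proof -
  define A where "A = {p. sublinear p \<and> (\<forall>x. p x \<le> q x)}"
  define P where "P p p' \<longleftrightarrow> (\<forall>x. p' x \<le> p x)" for p p' :: "'a \<Rightarrow> real"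
  have "\<exists>m\<in>A. \<forall>a\<in>A. P m a \<longrightarrow> a = m"
  proof (rule predicate_Zorn)
    show "partial_order_on A (relation_of P A)"
      unfolding partial_order_on_def preorder_on_def refl_on_def trans_def antisym_def relation_of_def P_def
      by (auto intro: order_trans intro!: ext antisym)
  next
    fix C assume C: "C \<in> Chains (relation_of P A)"
    then have CA: "C \<subseteq> A" and tot: "\<And>p p'. p \<in> C \<Longrightarrow> p' \<in> C \<Longrightarrow> P p p' \<or> P p' p"
      unfolding Chains_def relation_of_def by auto
    show "\<exists>u\<in>A. \<forall>a\<in>C. P a u"
    proof (cases "C = {}")
      case True
      moreover have "q \<in> A" using q by (simp add: A_def)
      ultimately show ?thesis by blast
    next
      case False
      define u where "u x = (INF p\<in>C. p x)" for x
      have "- q (- x) \<le> p x" if "p \<in> C" for p x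
      proof -
        have "sublinear p" "p (- x) \<le> q (- x)" using CA that by (auto simp: A_def)
        then show ?thesis using sublinear_lower[of p x] by simp
      qed
      then have bdd: "bdd_below ((\<lambda>p. p x) ` C)" for x by (auto intro!: bdd_belowI2)
      have up: "u x \<le> p x" if "p \<in> C" for p x unfolding u_def by (rule cINF_lower[OF bdd that])
      have "sublinear u"
        unfolding sublinear_def
      proof (intro conjI allI impI)
        fix x y
        have "u (x + y) \<le> p x + p' y" if pp: "p \<in> C" "p' \<in> C" for p p'
        proof -
          obtain r where r: "r \<in> C" "P p r" "P p' r" using tot[OF pp] pp unfolding P_def by auto
          have "u (x + y) \<le> r (x + y)" by (rule up[OF r(1)])
          also have "\<dots> \<le> r x + r y" using r CA sublinear_add unfolding A_def by blast
          also have "\<dots> \<le> p x + p' y" using r unfolding P_def by (intro add_mono) auto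
          finally show ?thesis .
        qed
        then have "u (x + y) - p' y \<le> u x" if "p' \<in> C" for p'
          unfolding u_def[of x] using that False by (intro cINF_greatest) (auto simp: algebra_simps)
        then have "u (x + y) - u x \<le> u y"
          unfolding u_def[of y] using False by (intro cINF_greatest) (auto simp: algebra_simps)
        then show "u (x + y) \<le> u x + u y" by simp
      next
        fix t x assume t: "(t::real) > 0"
        have "u (t *\<^sub>R x) / t \<le> u x"
          unfolding u_def[of x]
        proof (rule cINF_greatest[OF False])
          fix p assume p: "p \<in> C"
          then have "u (t *\<^sub>R x) \<le> p (t *\<^sub>R x)" by (rule up)
          also have "\<dots> \<le> t * p x" using p CA t sublinear_scale_le unfolding A_def by blast
          finally show "u (t *\<^sub>R x) / t \<le> p x" using t by (simp add: field_simps)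
        qed
        then show "u (t *\<^sub>R x) \<le> t * u x" using t by (simp add: field_simps)
      qed
      moreover obtain p where p: "p \<in> C" using False by blast
      have "u x \<le> q x" for x
      proof -
        have "p x \<le> q x" using p CA by (auto simp: A_def)
        then show ?thesis using up[OF p, of x] by linarith
      qed
      ultimately have "u \<in> A" by (simp add: A_def)
      then show ?thesis using up by (auto simp: P_def)
    qed
  qed
  then obtain p where p: "sublinear p" "\<forall>x. p x \<le> q x"
    and mn: "\<And>r. r \<in> A \<Longrightarrow> P p r \<Longrightarrow> r = p" unfolding A_def by blast
  have "linear p"
  proof (rule minimal_sublinear_linear[OF p(1)])
    fix r assume "sublinear r" "\<And>x. r x \<le> p x"
    then show "r = p" using p(2) by (intro mn) (simp_all add: A_def P_def, meson order_trans)
  qed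
  then show ?thesis using that p(2) by blast
qed

section \<open>Small elements of the Clarke gradient from a lower bound on the directional
  derivative\<close>

text \<open>The infimal convolution of the sublinear functional \<open>clarke_dderiv f x\<close>
  with \<open>\<epsilon>\<close> times the norm is finite by the lower bound. A linear functional
  below it lies below both, so it belongs to the gradient and has norm at most
  \<open>\<epsilon>\<close>.\<close>

lemma clarke_gradient_small_element:
  fixes f :: "'a::real_normed_vector \<Rightarrow> real"
  assumes f: "locally_lipschitz f" and e: "\<epsilon> \<ge> 0"
    and lower: "\<And>v. ereal (- \<epsilon> * norm v) \<le> clarke_dderiv f x v"
  obtains \<xi> where "\<xi> \<in> clarke_gradient f x" "norm \<xi> \<le> \<epsilon>"
proof -
  let ?F = "nhds x \<times>\<^sub>F at_right (0::real)"
  \<comment> \<open>Real upper bounds of the difference quotients near \<open>x\<close>: they lie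
    above the Clarke derivative and include every real strictly above it. Sets of bounds avoid
    arithmetic in the extended reals.\<close>
  define U where "U v = {a. eventually (\<lambda>(y, \<mu>). f (y + \<mu> *\<^sub>R v) - f y \<le> a * \<mu>) ?F}" for v
  have pos: "eventually (\<lambda>(y, \<mu>). \<mu> > 0) ?F"
    unfolding eventually_prod_filter
    by (rule exI[of _ "\<lambda>_. True"], rule exI[of _ "\<lambda>\<mu>. \<mu> > 0"]) (auto simp: eventually_at_right_less)
  have quot: "eventually (\<lambda>(y, \<mu>). f (y + \<mu> *\<^sub>R v) - f y \<le> a * \<mu>) ?F \<longleftrightarrow>
      eventually (\<lambda>(y, \<mu>). (f (y + \<mu> *\<^sub>R v) - f y) / \<mu> \<le> a) ?F" for v a
    by (rule eventually_cong[OF pos]) (auto simp: field_simps)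
  have UL: "clarke_dderiv f x v \<le> ereal a" if "a \<in> U v" for a v
    using that unfolding U_def clarke_dderiv_def quot mem_Collect_eq
    by (intro Limsup_bounded) (auto simp: case_prod_unfold)
  have LU: "a \<in> U v" if "clarke_dderiv f x v < ereal a" for a v
    using Limsup_lessD[OF that[unfolded clarke_dderiv_def]] unfolding U_def quot mem_Collect_eq
    by (rule eventually_mono) auto
  have Ulow: "- \<epsilon> * norm v \<le> a" if "a \<in> U v" for a v
    using order_trans[OF lower UL[OF that]] by simp
  have tend: "filterlim (\<lambda>(y, \<mu>). y + \<mu> *\<^sub>R v) (nhds x) ?F" for v
  proof -
    have "filterlim (\<lambda>p. fst p + snd p *\<^sub>R v) (nhds (x + 0 *\<^sub>R v)) ?F"
      by (intro tendsto_intros filterlim_fst filterlim_mono[OF filterlim_snd _ order_refl])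
         (simp add: at_within_le_nhds)
    then show ?thesis by (simp add: case_prod_unfold)
  qed
  \<comment> \<open>The increment along \<open>v + w\<close> is split at
    \<open>y + \<mu> *\<^sub>R v\<close>. This point still tends to \<open>x\<close>, and the
    derivative lets the base point vary in a full neighbourhood.\<close>
  have Uadd: "a + b \<in> U (v + w)" if "a \<in> U v" "b \<in> U w" for a b v w
  proof -
    have "filterlim (\<lambda>p. (fst p + snd p *\<^sub>R v, snd p)) ?F ?F"
      by (intro filterlim_Pair filterlim_snd) (use tend[of v] in \<open>simp add: case_prod_unfold\<close>)
    from eventually_compose_filterlim[OF that(2)[unfolded U_def mem_Collect_eq] this]
    have "eventually (\<lambda>p. f (fst p + snd p *\<^sub>R v + snd p *\<^sub>R w) - f (fst p + snd p *\<^sub>R v) \<le> b * snd p) ?F"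
      by simp
    with that(1)[unfolded U_def mem_Collect_eq] show ?thesis
      unfolding U_def mem_Collect_eq
      by eventually_elim (auto simp: algebra_simps)
  qed
  have Uscale: "t * a \<in> U (t *\<^sub>R v)" if "a \<in> U v" "t > 0" for a t v
  proof -
    have "filterlim (\<lambda>\<mu>. \<mu> * t) (nhds (0 * t)) (at_right 0)"
      by (intro tendsto_intros)
    then have "filterlim (\<lambda>\<mu>. \<mu> * t) (at_right 0) (at_right 0)"
      using that(2) by (auto simp: filterlim_at eventually_at_right_less intro!: eventually_mono[OF eventually_at_right_less[of 0]])
    then have "filterlim (\<lambda>p. (fst p, snd p * t)) ?F ?F"
      by (intro filterlim_Pair filterlim_fst filterlim_compose[OF _ filterlim_snd])
    from eventually_compose_filterlim[OF that(1)[unfolded U_def mem_Collect_eq] this]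
    have "eventually (\<lambda>p. f (fst p + (snd p * t) *\<^sub>R v) - f (fst p) \<le> a * (snd p * t)) ?F"
      by simp
    then show ?thesis unfolding U_def mem_Collect_eq by (simp add: case_prod_unfold mult_ac)
  qed
  have U0: "0 \<in> U 0" by (simp add: U_def case_prod_unfold)
  \<comment> \<open>A local Lipschitz constant bounds the quotients, so the Clarke derivative is
    below infinity.\<close>
  have Une: "\<exists>a. a \<in> U v" for v
  proof -
    obtain r L where r: "r > 0" and L: "L-lipschitz_on (ball x r) f"
      using f unfolding locally_lipschitz_def by blast
    have b: "eventually (\<lambda>y. y \<in> ball x r) (nhds x)" using r by (intro eventually_nhds_in_open) auto
    have "eventually (\<lambda>p. fst p \<in> ball x r) ?F"
      using eventually_compose_filterlim[OF b filterlim_fst] .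
    moreover have "eventually (\<lambda>p. fst p + snd p *\<^sub>R v \<in> ball x r) ?F"
      using eventually_compose_filterlim[OF b tend[of v]] by (simp add: case_prod_unfold)
    moreover have "eventually (\<lambda>p. snd p > 0) ?F" using pos by (simp add: case_prod_unfold)
    ultimately have "eventually (\<lambda>p. f (fst p + snd p *\<^sub>R v) - f (fst p) \<le> (L * norm v) * snd p) ?F"
    proof eventually_elim
      case (elim p)
      have "\<bar>f (fst p + snd p *\<^sub>R v) - f (fst p)\<bar> \<le> L * norm (snd p *\<^sub>R v)"
        using lipschitz_onD[OF L elim(2,1)] by (simp add: dist_norm)
      then show ?case using elim(3) by (simp add: mult_ac)
    qed
    then show ?thesis unfolding U_def by (auto simp: case_prod_unfold)
  qed
  \<comment> \<open>Upper bounds for the infimal convolution, whose value is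
    \<open>q v\<close>.\<close>
  define Q where "Q v = {s. \<exists>a w. a \<in> U (v + w) \<and> a + \<epsilon> * norm w \<le> s}" for v
  define q where "q v = Inf (Q v)" for v
  have Qne: "Q v \<noteq> {}" for v using Une[of "v + 0"] unfolding Q_def by blast
  have Qlow: "- \<epsilon> * norm v \<le> s" if "s \<in> Q v" for s v
  proof -
    obtain a w where s: "a + \<epsilon> * norm w \<le> s" "a \<in> U (v + w)" using \<open>s \<in> Q v\<close> unfolding Q_def by blast
    have "\<epsilon> * norm (v + w) \<le> \<epsilon> * norm v + \<epsilon> * norm w"
      using e by (simp add: distrib_left[symmetric] norm_triangle_ineq mult_left_mono)
    then show ?thesis using Ulow[OF s(2)] s(1) by simp
  qed
  have Qbdd: "bdd_below (Q v)" for v using Qlow by (rule bdd_belowI)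
  have qle: "q v \<le> s" if "s \<in> Q v" for s v unfolding q_def by (rule cInf_lower[OF that Qbdd])
  have Qadd: "s + t \<in> Q (v + w)" if st: "s \<in> Q v" "t \<in> Q w" for s t v w
  proof -
    obtain a v' b w' where s: "a \<in> U (v + v')" "a + \<epsilon> * norm v' \<le> s"
      and t: "b \<in> U (w + w')" "b + \<epsilon> * norm w' \<le> t" using st unfolding Q_def by blast
    have "a + b \<in> U ((v + w) + (v' + w'))" using Uadd[OF s(1) t(1)] by (simp add: algebra_simps)
    moreover have "\<epsilon> * norm (v' + w') \<le> \<epsilon> * norm v' + \<epsilon> * norm w'"
      using e by (simp add: distrib_left[symmetric] norm_triangle_ineq mult_left_mono)
    then have "(a + b) + \<epsilon> * norm (v' + w') \<le> s + t" using s(2) t(2) by simp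
    ultimately show ?thesis unfolding Q_def by blast
  qed
  have Qscale: "t * s \<in> Q (t *\<^sub>R v)" if "s \<in> Q v" "t > 0" for s t v
  proof -
    obtain a w where s: "a \<in> U (v + w)" "a + \<epsilon> * norm w \<le> s" using \<open>s \<in> Q v\<close> unfolding Q_def by blast
    have "t * a \<in> U (t *\<^sub>R v + t *\<^sub>R w)" using Uscale[OF s(1) that(2)] by (simp add: algebra_simps)
    moreover have "t * a + \<epsilon> * norm (t *\<^sub>R w) \<le> t * s"
      using mult_left_mono[OF s(2), of t] that(2) by (simp add: algebra_simps)
    ultimately show ?thesis unfolding Q_def by blast
  qed
  have "sublinear q"
    unfolding sublinear_def
  proof (intro conjI allI impI)
    fix v w
    have "q (v + w) - t \<le> q v" if "t \<in> Q w" for t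
      unfolding q_def[of v] using qle[OF Qadd] that
      by (intro cInf_greatest[OF Qne]) (auto simp: algebra_simps)
    then have "q (v + w) - q v \<le> q w"
      unfolding q_def[of w] by (intro cInf_greatest[OF Qne]) (auto simp: algebra_simps)
    then show "q (v + w) \<le> q v + q w" by simp
  next
    fix t v assume t: "(t::real) > 0"
    have "q (t *\<^sub>R v) / t \<le> q v"
      unfolding q_def[of v] using qle[OF Qscale] t
      by (intro cInf_greatest[OF Qne]) (auto simp: field_simps)
    then show "q (t *\<^sub>R v) \<le> t * q v" using t by (simp add: field_simps)
  qed
  then obtain p where p: "linear p" "\<And>v. p v \<le> q v" by (rule hahn_banach_sublinear) blast
  \<comment> \<open>Taking \<open>w = 0\<close> in the convolution puts \<open>p\<close> below the
    Clarke derivative; \<open>w = - v\<close> then puts it below the scaled norm.\<close>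
  have pU: "p v \<le> a" if "a \<in> U v" for a v
  proof -
    have "a \<in> Q v" unfolding Q_def mem_Collect_eq using that by (intro exI[of _ a] exI[of _ "0::'a"]) simp
    then show ?thesis using p(2) qle order_trans by blast
  qed
  have pe: "p v \<le> \<epsilon> * norm v" for v
  proof -
    have "\<epsilon> * norm v \<in> Q v" unfolding Q_def mem_Collect_eq using U0 by (intro exI[of _ "0::real"] exI[of _ "- v"]) simp
    then show ?thesis using p(2) qle order_trans by blast
  qed
  have pabs: "norm (p v) \<le> \<epsilon> * norm v" for v
    using pe[of v] pe[of "- v"] linear_neg[OF p(1), of v] by simp
  have bl: "bounded_linear p"
    by (rule bounded_linear_intro[where K = \<epsilon>])
       (use p(1) pabs in \<open>auto simp: linear_add linear_scale mult.commute\<close>)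
  show ?thesis
  proof
    have "ereal (p v) \<le> clarke_dderiv f x v" for v
    proof (rule ccontr)
      assume "\<not> ?thesis"
      then obtain a where "clarke_dderiv f x v < ereal a" "a < p v"
        using ereal_dense2[of "clarke_dderiv f x v" "ereal (p v)"] by (auto simp: not_le)
      then show False using pU[OF LU] by fastforce
    qed
    then show "Blinfun p \<in> clarke_gradient f x"
      by (simp add: clarke_gradient_def bounded_linear_Blinfun_apply[OF bl])
    show "norm (Blinfun p) \<le> \<epsilon>"
      using norm_blinfun_bound[OF e, of "Blinfun p"] pabs by (simp add: bounded_linear_Blinfun_apply[OF bl])
  qed
qed

subsection \<open>Finite-dimensional subspaces and linking\<close>

text \<open>Points of \<open>\<real>\<^sup>n\<close> are sequences vanishing from index \<open>n\<close> on, the encoding used for \<open>nsphere\<close>.\<close>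

lemma compact_coordinate_sphere:
  "compact {v :: nat \<Rightarrow> real. (\<Sum>i<n. (v i)\<^sup>2) = 1 \<and> (\<forall>i\<ge>n. v i = 0)}" (is "compact ?N")
proof -
  have "compactin (product_topology (\<lambda>i::nat. euclidean) UNIV) (PiE UNIV (\<lambda>i. {-1..1::real}))"
    by (auto simp: compactin_PiE)
  then have C: "compact (PiE UNIV (\<lambda>i::nat. {-1..1::real}))"
    by (simp add: euclidean_product_topology)
  have "?N = {v. (\<Sum>i<n. (v i)\<^sup>2) = 1} \<inter> (\<Inter>i\<in>{n..}. {v. v i = 0})" by auto
  moreover have "closed \<dots>"
    by (intro closed_Int closed_INT ballI closed_Collect_eq continuous_intros
        continuous_on_product_coordinates)
  ultimately have cl: "closed ?N" by simp
  have "?N \<subseteq> PiE UNIV (\<lambda>i::nat. {-1..1::real})"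
  proof
    fix v assume v: "v \<in> ?N"
    have "\<bar>v i\<bar> \<le> 1" for i
    proof (cases "i < n")
      case True
      then have "(v i)\<^sup>2 \<le> (\<Sum>i<n. (v i)\<^sup>2)" by (intro member_le_sum) auto
      then show ?thesis using v by (simp add: abs_square_le_1)
    qed (use v in auto)
    then show "v \<in> PiE UNIV (\<lambda>i::nat. {-1..1::real})" by (auto simp: abs_le_iff minus_le_iff)
  qed
  then show ?thesis using compact_Int_closed[OF C cl] by (simp add: Int_absorb1)
qed

text \<open>A linear homeomorphism of \<real>^n with \<open>S\<close>: \<open>\<psi>\<close> is
  defined on all sequences, \<open>\<phi>\<close> inverts it on those vanishing from
  \<open>n\<close> on, and \<open>m\<close> compares the Euclidean norm of the coordinates with the
  norm of the space.\<close>

definition coordinate_system ::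
    "'a::real_normed_vector set \<Rightarrow> nat \<Rightarrow> real \<Rightarrow> ((nat \<Rightarrow> real) \<Rightarrow> 'a) \<Rightarrow> ('a \<Rightarrow> nat \<Rightarrow> real) \<Rightarrow> bool" where
  "coordinate_system S n m \<psi> \<phi> \<longleftrightarrow>
     (\<forall>a u b v. \<psi> (\<lambda>i. a * u i + b * v i) = a *\<^sub>R \<psi> u + b *\<^sub>R \<psi> v) \<and>
     continuous_on UNIV \<psi> \<and> (\<forall>v. \<psi> v \<in> S) \<and> continuous_on S \<phi> \<and>
     (\<forall>x\<in>S. \<psi> (\<phi> x) = x \<and> (\<forall>i\<ge>n. \<phi> x i = 0)) \<and>
     (\<forall>v. (\<forall>i\<ge>n. v i = 0) \<longrightarrow> \<phi> (\<psi> v) = v) \<and>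
     m > 0 \<and> (\<forall>v. m * sqrt (\<Sum>i<n. (v i)\<^sup>2) \<le> norm (\<psi> v))"

lemma coordinate_systemD:
  assumes "coordinate_system S n m \<psi> \<phi>"
  shows "\<psi> (\<lambda>i. a * u i + b * v i) = a *\<^sub>R \<psi> u + b *\<^sub>R \<psi> v"
    and "continuous_on UNIV \<psi>" and "\<psi> v \<in> S" and "continuous_on S \<phi>"
    and "x \<in> S \<Longrightarrow> \<psi> (\<phi> x) = x" and "x \<in> S \<Longrightarrow> i \<ge> n \<Longrightarrow> \<phi> x i = 0"
    and "(\<And>i. i \<ge> n \<Longrightarrow> v i = 0) \<Longrightarrow> \<phi> (\<psi> v) = v"
    and "m > 0" and "m * sqrt (\<Sum>i<n. (v i)\<^sup>2) \<le> norm (\<psi> v)"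
  using assms unfolding coordinate_system_def by blast+

text \<open>A basis provides the linear bijection. On the compact Euclidean unit sphere the norm of
  its values attains a minimum, positive by independence; scaling gives the lower bound, which makes
  the coordinates Lipschitz.\<close>

lemma finite_dimensional_coordinates:
  fixes S :: "'a::real_normed_vector set"
  assumes "finite_dimensional_subspace S"
  obtains n m \<psi> \<phi> where "coordinate_system S n m \<psi> \<phi>"
proof -
  obtain B0 where B0: "finite B0" "S = span B0" using assms by (auto simp: finite_dimensional_subspace_def)
  obtain B where B: "B \<subseteq> B0" "independent B" "B0 \<subseteq> span B"
    using maximal_independent_subset[of B0] by blast
  have finB: "finite B" using B B0 finite_subset by blast
  have SB: "S = span B" unfolding B0(2)
    by (metis B(1,3) span_mono span_span subset_antisym)
  define n where "n = card B"
  obtain b where b: "bij_betw b {..<n} B"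
    using ex_bij_betw_nat_finite[OF finB] by (auto simp: n_def lessThan_atLeast0)
  define \<psi> where "\<psi> v = (\<Sum>i<n. v i *\<^sub>R b i)" for v :: "nat \<Rightarrow> real"
  define V where "V = {v :: nat \<Rightarrow> real. \<forall>i\<ge>n. v i = 0}"
  define N where "N = {v :: nat \<Rightarrow> real. (\<Sum>i<n. (v i)\<^sup>2) = 1 \<and> (\<forall>i\<ge>n. v i = 0)}"
  have lin: "\<psi> (\<lambda>i. a * u i + c * v i) = a *\<^sub>R \<psi> u + c *\<^sub>R \<psi> v" for a u c v
    by (simp add: \<psi>_def scaleR_sum_right sum.distrib[symmetric] algebra_simps)
  have cont: "continuous_on A \<psi>" for A
    unfolding \<psi>_def
    by (intro continuous_intros continuous_on_subset[OF continuous_on_product_coordinates]) auto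
  have \<psi>S: "\<psi> v \<in> S" for v
    unfolding \<psi>_def SB using b by (intro span_sum span_scale span_base) (auto simp: bij_betw_def)
  have inv: "(\<Sum>x\<in>B. g x) = (\<Sum>i<n. g (b i))" for g :: "'a \<Rightarrow> 'a"
    using sum.reindex_bij_betw[OF b, of g] by simp
  have surj: "\<exists>v\<in>V. \<psi> v = x" if "x \<in> S" for x
  proof -
    obtain u where u: "x = (\<Sum>w\<in>B. u w *\<^sub>R w)" using \<open>x \<in> S\<close> unfolding SB span_finite[OF finB] by (rule imageE)
    then show ?thesis
      by (intro bexI[of _ "\<lambda>i. if i < n then u (b i) else 0"]) (auto simp: \<psi>_def V_def inv)
  qed
  have ker: "v i = 0" if "\<psi> v = 0" "i < n" for v i
  proof -
    define u where "u w = v (inv_into {..<n} b w)" for w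
    have u: "u (b j) = v j" if "j < n" for j
      using b that by (simp add: u_def bij_betw_def inv_into_f_f)
    have "(\<Sum>w\<in>B. u w *\<^sub>R w) = \<psi> v" by (simp add: inv \<psi>_def u)
    then have "u (b i) = 0"
      using independentD[OF B(2) finB order_refl, of u "b i"] \<open>\<psi> v = 0\<close> b \<open>i < n\<close> by (auto simp: bij_betw_def)
    then show ?thesis using u \<open>i < n\<close> by simp
  qed
  have inj: "u = v" if "u \<in> V" "v \<in> V" "\<psi> u = \<psi> v" for u v
  proof
    fix i
    have "\<psi> (\<lambda>i. 1 * u i + (-1) * v i) = 0" unfolding lin using that(3) by simp
    from ker[OF this] show "u i = v i" using that(1,2) by (cases "i < n") (auto simp: V_def)
  qed
  obtain m where m: "m > 0" "\<And>v. v \<in> N \<Longrightarrow> m \<le> norm (\<psi> v)"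
  proof (cases "N = {}")
    \<comment> \<open>The sphere is empty exactly when \<open>n = 0\<close>; any positive constant
      then serves.\<close>
    case True then show ?thesis using that[of 1] by simp
  next
    case False
    have "compact N" unfolding N_def by (rule compact_coordinate_sphere)
    then obtain v where v: "v \<in> N" "\<And>w. w \<in> N \<Longrightarrow> norm (\<psi> v) \<le> norm (\<psi> w)"
      using continuous_attains_inf[OF _ False, of "\<lambda>v. norm (\<psi> v)"] continuous_on_norm[OF cont] by blast
    have "\<psi> v \<noteq> 0"
    proof
      assume "\<psi> v = 0"
      then have "(\<Sum>i<n. (v i)\<^sup>2) = 0" using ker by (intro sum.neutral) auto
      then show False using v(1) by (simp add: N_def)
    qed
    then show ?thesis using that[of "norm (\<psi> v)"] v(2) by simp
  qed
  have lower: "m * sqrt (\<Sum>i<n. (v i)\<^sup>2) \<le> norm (\<psi> v)" for v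
  proof -
    define s where "s = sqrt (\<Sum>i<n. (v i)\<^sup>2)"
    show ?thesis
    proof (cases "s = 0")
      case False
      then have s: "s > 0" by (simp add: s_def sum_nonneg order_less_le)
      have s2: "s\<^sup>2 = (\<Sum>i<n. (v i)\<^sup>2)" by (simp add: s_def sum_nonneg)
      define w where "w i = (if i < n then v i / s else 0)" for i
      have "w \<in> N" using s by (simp add: N_def w_def power_divide sum_divide_distrib[symmetric] s2[symmetric])
      moreover have "\<psi> w = (1 / s) *\<^sub>R \<psi> v" by (simp add: \<psi>_def w_def scaleR_sum_right)
      ultimately have "m \<le> norm (\<psi> v) / s" using m(2)[of w] s by simp
      then show ?thesis using s by (simp add: s_def field_simps)
    qed (simp add: s_def)
  qed
  define \<phi> where "\<phi> = inv_into V \<psi>"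
  have \<phi>V: "\<phi> x \<in> V" and \<psi>\<phi>: "\<psi> (\<phi> x) = x" if "x \<in> S" for x
  proof -
    have "x \<in> \<psi> ` V" using surj[OF that] by blast
    then show "\<phi> x \<in> V" "\<psi> (\<phi> x) = x" unfolding \<phi>_def by (rule inv_into_into, rule f_inv_into_f)
  qed
  have \<phi>\<psi>: "\<phi> (\<psi> v) = v" if "v \<in> V" for v
    by (rule inj[OF \<phi>V that \<psi>\<phi>]) (rule \<psi>S)+
  have coord: "\<bar>\<phi> x i - \<phi> y i\<bar> \<le> (1 / m) * norm (x - y)" if xy: "x \<in> S" "y \<in> S" for x y i
  proof (cases "i < n")
    case True
    define w where "w = (\<lambda>i. 1 * \<phi> x i + (-1) * \<phi> y i)"
    have "\<psi> w = x - y" unfolding w_def lin using \<psi>\<phi> xy by simp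
    moreover have "(w i)\<^sup>2 \<le> (\<Sum>i<n. (w i)\<^sup>2)" using True by (intro member_le_sum) auto
    then have "\<bar>w i\<bar> \<le> sqrt (\<Sum>i<n. (w i)\<^sup>2)" by (simp add: real_le_rsqrt)
    then have "m * \<bar>w i\<bar> \<le> m * sqrt (\<Sum>i<n. (w i)\<^sup>2)" using m(1) by simp
    ultimately have "m * \<bar>w i\<bar> \<le> norm (x - y)" using lower[of w] by simp
    then show ?thesis using m(1) by (simp add: w_def field_simps)
  next
    case False
    then show ?thesis using \<phi>V[OF xy(1)] \<phi>V[OF xy(2)] m(1) by (simp add: V_def)
  qed
  have "continuous_on S \<phi>"
  proof (rule continuous_on_coordinatewise_then_product)
    fix i
    have "(1 / m)-lipschitz_on S (\<lambda>x. \<phi> x i)"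
      using coord m(1) by (intro lipschitz_onI) (auto simp: dist_norm)
    then show "continuous_on S (\<lambda>x. \<phi> x i)" by (rule lipschitz_on_continuous_on)
  qed
  then show ?thesis
    using that[of n m \<psi> \<phi>] lin cont \<psi>S \<psi>\<phi> \<phi>V \<phi>\<psi> m(1) lower
    unfolding coordinate_system_def by (simp add: V_def)
qed

text \<open>Coordinates of points of the ball are bounded by \<open>r / m\<close>, so the ball is
  the image under \<open>\<psi>\<close> of a closed part of a product of compact intervals.\<close>

lemma compact_finite_dimensional_cball:
  fixes S :: "'a::real_normed_vector set"
  assumes "finite_dimensional_subspace S"
  shows "compact {x \<in> S. norm x \<le> r}"
proof -
  obtain n m \<psi> \<phi> where cs: "coordinate_system S n m \<psi> \<phi>"
    by (rule finite_dimensional_coordinates[OF assms])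
  note c\<psi> = coordinate_systemD(2)[OF cs] and \<psi>S = coordinate_systemD(3)[OF cs]
    and \<psi>\<phi> = coordinate_systemD(5)[OF cs] and \<phi>0 = coordinate_systemD(6)[OF cs]
    and m = coordinate_systemD(8)[OF cs] and lower = coordinate_systemD(9)[OF cs]
  define P where "P = PiE UNIV (\<lambda>i::nat. {- r / m..r / m})"
  define C where "C = P \<inter> {v. norm (\<psi> v) \<le> r}"
  have "compactin (product_topology (\<lambda>i::nat. euclidean) UNIV) P"
    by (auto simp: compactin_PiE P_def)
  then have "compact P" by (simp add: euclidean_product_topology)
  moreover have "closed {v. norm (\<psi> v) \<le> r}"
    by (intro closed_Collect_le continuous_intros c\<psi>)
  ultimately have C: "compact C" unfolding C_def by (rule compact_Int_closed)
  have "{x \<in> S. norm x \<le> r} = \<psi> ` C"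
  proof (intro equalityI subsetI)
    fix x assume x: "x \<in> {x \<in> S. norm x \<le> r}"
    then have r: "r \<ge> 0" using norm_ge_zero[of x] by (simp del: norm_ge_zero)
    have "\<bar>\<phi> x i\<bar> \<le> r / m" for i
    proof (cases "i < n")
      case True
      then have "(\<phi> x i)\<^sup>2 \<le> (\<Sum>i<n. (\<phi> x i)\<^sup>2)" by (intro member_le_sum) auto
      then have "\<bar>\<phi> x i\<bar> \<le> sqrt (\<Sum>i<n. (\<phi> x i)\<^sup>2)" by (simp add: real_le_rsqrt)
      then have "m * \<bar>\<phi> x i\<bar> \<le> m * sqrt (\<Sum>i<n. (\<phi> x i)\<^sup>2)" using m by simp
      then have "m * \<bar>\<phi> x i\<bar> \<le> r" using lower[of "\<phi> x"] \<psi>\<phi> x by auto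
      then show ?thesis using m by (simp add: field_simps)
    next
      case False
      then show ?thesis using \<phi>0 x r m by simp
    qed
    then have "\<phi> x \<in> P" by (auto simp: P_def abs_le_iff minus_le_iff)
    then have "\<phi> x \<in> C" using \<psi>\<phi> x by (simp add: C_def)
    then show "x \<in> \<psi> ` C" using \<psi>\<phi> x by (metis (mono_tags, lifting) imageI mem_Collect_eq)
  qed (use \<psi>S in \<open>auto simp: C_def\<close>)
  then show ?thesis using compact_continuous_image[OF continuous_on_subset[OF c\<psi>] C] by simp
qed

text \<open>If \<open>q\<close> missed \<open>z\<close>, then \<open>q - z\<close> would be a
  zero-free map on the whole ball, and normalizing it would contract the Euclidean unit
  sphere.\<close>

lemma finite_dimensional_linking:
  fixes S :: "'a::real_normed_vector set"
  assumes S: "finite_dimensional_subspace S" and z: "z \<in> S" "norm z < R"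
    and q: "continuous_on {x \<in> S. norm x \<le> R} q" "\<And>x. x \<in> S \<Longrightarrow> norm x \<le> R \<Longrightarrow> q x \<in> S"
    and bdry: "\<And>x. x \<in> S \<Longrightarrow> norm x = R \<Longrightarrow> q x = x"
  shows "\<exists>x\<in>S. norm x \<le> R \<and> q x = z"
proof (rule ccontr)
  assume neg: "\<not> ?thesis"
  have R: "R > 0" using z(2) norm_ge_zero[of z] by linarith
  have sub: "subspace S" using S by (auto simp: finite_dimensional_subspace_def)
  obtain n m \<psi> \<phi> where cs: "coordinate_system S n m \<psi> \<phi>"
    by (rule finite_dimensional_coordinates[OF S])
  note lin = coordinate_systemD(1)[OF cs] and c\<psi> = coordinate_systemD(2)[OF cs]
    and \<psi>S = coordinate_systemD(3)[OF cs] and c\<phi> = coordinate_systemD(4)[OF cs]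
    and \<psi>\<phi> = coordinate_systemD(5)[OF cs] and \<phi>0 = coordinate_systemD(6)[OF cs]
    and \<phi>\<psi> = coordinate_systemD(7)[OF cs]
    and m = coordinate_systemD(8)[OF cs] and lower = coordinate_systemD(9)[OF cs]
  define N where "N = {v :: nat \<Rightarrow> real. (\<Sum>i<n. (v i)\<^sup>2) = 1 \<and> (\<forall>i\<ge>n. v i = 0)}"
  define l where "l x = sqrt (\<Sum>i<n. (\<phi> x i)\<^sup>2)" for x
  \<comment> \<open>\<open>\<beta>\<close> projects \<open>S - {0}\<close> radially onto the
    coordinate sphere \<open>N\<close>, and \<open>e\<close> carries \<open>N\<close> to the sphere
    of radius \<open>R\<close> in the norm of the space; \<open>\<beta>\<close> undoes
    \<open>e\<close>.\<close>
  define \<beta> where "\<beta> x = (\<lambda>i. \<phi> x i / l x)" for x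
  define e where "e v = (R / norm (\<psi> v)) *\<^sub>R \<psi> v" for v
  have \<psi>0: "\<psi> (\<lambda>i. 0) = 0" using lin[of 0 _ 0] by simp
  have l0: "l x > 0" if "x \<in> S - {0}" for x
  proof -
    have "l x \<noteq> 0"
    proof
      assume "l x = 0"
      then have z: "\<phi> x i = 0" if "i < n" for i using that by (simp add: l_def sum_nonneg_eq_0_iff)
      then have "\<phi> x i = 0" for i using \<phi>0[of x i] that z[of i] by (cases "i < n") auto
      then have "\<phi> x = (\<lambda>i. 0)" by blast
      then show False using \<psi>\<phi>[of x] \<psi>0 that by simp
    qed
    moreover have "l x \<ge> 0" by (simp add: l_def sum_nonneg)
    ultimately show ?thesis by simp
  qed
  have c\<phi>i: "continuous_on (S - {0}) (\<lambda>x. \<phi> x i)" for i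
    by (rule continuous_on_product_then_coordinatewise, rule continuous_on_subset[OF c\<phi>]) auto
  have cl: "continuous_on (S - {0}) l"
    unfolding l_def by (intro continuous_intros c\<phi>i)
  have c\<beta>: "continuous_on (S - {0}) \<beta>"
    unfolding \<beta>_def
    by (rule continuous_on_coordinatewise_then_product, rule continuous_on_divide[OF c\<phi>i cl])
       (use l0 in force)
  have \<beta>N: "\<beta> x \<in> N" if "x \<in> S - {0}" for x
  proof -
    have "(\<Sum>i<n. (\<beta> x i)\<^sup>2) = (\<Sum>i<n. (\<phi> x i)\<^sup>2) / (l x)\<^sup>2"
      by (simp add: \<beta>_def power_divide sum_divide_distrib)
    also have "(l x)\<^sup>2 = (\<Sum>i<n. (\<phi> x i)\<^sup>2)" by (simp add: l_def sum_nonneg)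
    finally show ?thesis using l0[OF that] \<open>(l x)\<^sup>2 = _\<close> \<phi>0 that by (auto simp: N_def \<beta>_def)
  qed
  have N\<psi>: "norm (\<psi> v) > 0" if "v \<in> N" for v using lower[of v] m that by (auto simp: N_def)
  have ce: "continuous_on N e"
    unfolding e_def
    by (intro continuous_intros continuous_on_subset[OF c\<psi>]) (use N\<psi> in auto)
  have eS: "e v \<in> S" for v unfolding e_def by (intro subspace_scale[OF sub] \<psi>S)
  have en: "norm (e v) = R" if "v \<in> N" for v using N\<psi>[OF that] R by (simp add: e_def)
  have \<beta>e: "\<beta> (e v) = v" if v: "v \<in> N" for v
  proof -
    define t where "t = R / norm (\<psi> v)"
    have t: "t > 0" using N\<psi>[OF v] R by (simp add: t_def)
    have "e v = \<psi> (\<lambda>i. t * v i)" using lin[of t v 0 v] by (simp add: e_def t_def)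
    then have \<phi>e: "\<phi> (e v) = (\<lambda>i. t * v i)" using \<phi>\<psi>[of "\<lambda>i. t * v i"] v by (simp add: N_def)
    have "(\<Sum>i<n. (t * v i)\<^sup>2) = t\<^sup>2" using v by (simp add: power_mult_distrib sum_distrib_left[symmetric] N_def)
    then have "l (e v) = t" using t by (simp add: l_def \<phi>e)
    then show ?thesis using t by (simp add: \<beta>_def \<phi>e fun_eq_iff)
  qed
  have hom: "homotopic_with_canon (\<lambda>x. True) N N (\<lambda>v. \<beta> (h (0, v))) (\<lambda>v. \<beta> (h (1, v)))"
    if "continuous_on ({0..1} \<times> N) h" "h ` ({0..1} \<times> N) \<subseteq> S - {0}" for h :: "real \<times> (nat \<Rightarrow> real) \<Rightarrow> 'a"
    unfolding homotopic_with_def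
  proof (intro exI[of _ "\<lambda>p. \<beta> (h p)"] conjI)
    have "continuous_on ({0..1} \<times> N) (\<lambda>p. \<beta> (h p))"
      by (rule continuous_on_compose2[OF c\<beta> that])
    moreover have "(\<lambda>p. \<beta> (h p)) ` ({0..1} \<times> N) \<subseteq> N" using that(2) \<beta>N by blast
    ultimately show "continuous_map (prod_topology (top_of_set {0..1}) (top_of_set N)) (top_of_set N) (\<lambda>p. \<beta> (h p))"
      by (simp add: prod_topology_subtopology_eu image_subset_iff_funcset)
  qed auto
  txt \<open>If \<open>q\<close> misses \<open>z\<close>, contract the sphere by moving \<open>e v\<close> to \<open>e v - z = q (e v) - z\<close> and then
    shrinking the argument of \<open>q\<close> to \<open>0\<close>.\<close>
  have h1: "homotopic_with_canon (\<lambda>x. True) N N (\<lambda>v. \<beta> (e v - 0 *\<^sub>R z)) (\<lambda>v. \<beta> (e v - 1 *\<^sub>R z))"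
  proof (rule hom[of "\<lambda>p. e (snd p) - fst p *\<^sub>R z", simplified fst_conv snd_conv])
    show "continuous_on ({0..1} \<times> N) (\<lambda>p. e (snd p) - fst p *\<^sub>R z)"
      by (intro continuous_intros continuous_on_compose2[OF ce]) auto
    \<comment> \<open>Here \<open>z\<close> lies strictly inside the ball, so a multiple
      \<open>t *\<^sub>R z\<close> with \<open>t\<close> in the unit interval cannot reach norm
      \<open>R\<close>.\<close>
    have "e v - t *\<^sub>R z \<noteq> 0" if "v \<in> N" "t \<in> {0..1}" for v t
    proof
      assume "e v - t *\<^sub>R z = 0"
      then have "R = t * norm z" using en[OF that(1)] that(2) by auto
      then show False using z(2) that(2) mult_left_le_one_le[of "norm z" t] by auto
    qed
    then show "(\<lambda>p. e (snd p) - fst p *\<^sub>R z) ` ({0..1} \<times> N) \<subseteq> S - {0}"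
      using eS z(1) sub by (auto simp: subspace_diff subspace_scale)
  qed
  have h2: "homotopic_with_canon (\<lambda>x. True) N N
      (\<lambda>v. \<beta> (q ((1 - 0) *\<^sub>R e v) - z)) (\<lambda>v. \<beta> (q ((1 - 1) *\<^sub>R e v) - z))"
  proof (rule hom[of "\<lambda>p. q ((1 - fst p) *\<^sub>R e (snd p)) - z", simplified fst_conv snd_conv])
    have im: "(1 - t) *\<^sub>R e v \<in> S \<and> norm ((1 - t) *\<^sub>R e v) \<le> R" if "v \<in> N" "t \<in> {0..1}" for v t
      using that eS sub en[of v] R by (auto simp: subspace_scale mult_left_le_one_le)
    show "continuous_on ({0..1} \<times> N) (\<lambda>p. q ((1 - fst p) *\<^sub>R e (snd p)) - z)"
      by (intro continuous_on_diff continuous_on_compose2[OF q(1)] continuous_intros continuous_on_compose2[OF ce])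
         (use im in auto)
    show "(\<lambda>p. q ((1 - fst p) *\<^sub>R e (snd p)) - z) ` ({0..1} \<times> N) \<subseteq> S - {0}"
      using im neg q(2) z(1) sub by (fastforce simp: subspace_diff)
  qed
  have c1: "continuous_on N (\<lambda>v. \<beta> (e v - 1 *\<^sub>R z)) \<and> (\<lambda>v. \<beta> (e v - 1 *\<^sub>R z)) ` N \<subseteq> N"
    using homotopic_with_imp_continuous[OF h1] homotopic_with_imp_subset2[OF h1] by simp
  \<comment> \<open>The two homotopies fit together because \<open>q\<close> fixes the sphere
    pointwise.\<close>
  have h3: "homotopic_with_canon (\<lambda>x. True) N N (\<lambda>v. \<beta> (e v - 1 *\<^sub>R z)) (\<lambda>v. \<beta> (q ((1 - 0) *\<^sub>R e v) - z))"
    by (rule homotopic_with_equal) (use bdry eS en c1 in \<open>auto\<close>)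
  have h4: "homotopic_with_canon (\<lambda>x. True) N N (\<lambda>v. \<beta> (e v)) (\<lambda>v. \<beta> (q 0 - z))"
    using homotopic_with_trans[OF homotopic_with_trans[OF h1 h3] h2] by simp
  have "homotopic_with_canon (\<lambda>x. True) N N id (\<lambda>v. \<beta> (q 0 - z))"
    using homotopic_with_eq[OF h4, of id "\<lambda>v. \<beta> (q 0 - z)"] \<beta>e by simp
  then have contr: "contractible N" unfolding contractible_def by blast
  show False
  proof (cases n)
    \<comment> \<open>Now \<open>N\<close> is empty and contractibility gives no contradiction; but
      \<open>S\<close> is trivial, so \<open>q 0\<close> and \<open>z\<close> are both
      \<open>0\<close>.\<close>
    case 0
    have "x = 0" if "x \<in> S" for x
    proof -
      have "\<phi> x = (\<lambda>i. 0)" using \<phi>0[OF that] 0 by auto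
      then show ?thesis using \<psi>\<phi>[OF that] \<psi>0 by simp
    qed
    from this[OF q(2)[of 0]] this[OF z(1)] show False using neg subspace_0[OF sub] R by auto
  next
    case (Suc k)
    \<comment> \<open>\<open>nsphere k\<close> lives in coordinates \<open>0\<close> to
      \<open>k\<close>, which are \<open>n = Suc k\<close> in number.\<close>
    have "nsphere k = top_of_set N"
      by (simp add: nsphere N_def Suc euclidean_product_topology lessThan_Suc_atMost Suc_le_eq)
    then show False using non_contractible_space_nsphere[of k] contr by simp
  qed
qed

section \<open>Local descent and closedness properties of the Clarke gradient\<close>

lemma locally_lipschitz_continuous:
  fixes f :: "'a::metric_space \<Rightarrow> 'b::metric_space"
  assumes "locally_lipschitz f"
  shows "continuous_on UNIV f"
  unfolding continuous_on_eq_continuous_at[OF open_UNIV]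
proof
  fix x
  obtain r L where r: "r > 0" and L: "L-lipschitz_on (ball x r) f"
    using assms unfolding locally_lipschitz_def by blast
  have "continuous_on (ball x r) f" using L by (rule lipschitz_on_continuous_on)
  then show "isCont f x" using r by (simp add: continuous_on_eq_continuous_at)
qed

text \<open>Supplies decrease that is uniform in the base point \<open>u\<close>, so that one
  direction serves a whole neighbourhood.\<close>

lemma clarke_dderiv_lessD:
  assumes "clarke_dderiv f x v < ereal a"
  obtains \<delta> where "\<delta> > 0"
    "\<And>u s. dist u x < \<delta> \<Longrightarrow> 0 < s \<Longrightarrow> s < \<delta> \<Longrightarrow> f (u + s *\<^sub>R v) < f u + a * s"
proof -
  have "eventually (\<lambda>(y, \<mu>). ereal ((f (y + \<mu> *\<^sub>R v) - f y) / \<mu>) < ereal a) (nhds x \<times>\<^sub>F at_right 0)"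
    using Limsup_lessD[OF assms[unfolded clarke_dderiv_def]] by (simp add: case_prod_unfold)
  then obtain P Q where P: "eventually P (nhds x)" and Q: "eventually Q (at_right (0::real))"
    and PQ: "\<And>y \<mu>. P y \<Longrightarrow> Q \<mu> \<Longrightarrow> (f (y + \<mu> *\<^sub>R v) - f y) / \<mu> < a"
    unfolding eventually_prod_filter by auto
  obtain d where d: "d > 0" "\<And>y. dist y x < d \<Longrightarrow> P y" using P unfolding eventually_nhds_metric by blast
  obtain b where b: "b > 0" "\<And>s. 0 < s \<Longrightarrow> s < b \<Longrightarrow> Q s" using Q unfolding eventually_at_right_field by blast
  show ?thesis
  proof
    show "min d b > 0" using d b by simp
    fix u s assume us: "dist u x < min d b" "0 < s" "s < min d b"
    then have "(f (u + s *\<^sub>R v) - f u) / s < a" using d b by (intro PQ) auto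
    then show "f (u + s *\<^sub>R v) < f u + a * s" using us(2) by (simp add: field_simps)
  qed
qed

lemma clarke_dderiv_leI:
  assumes "\<delta> > 0"
    "\<And>u s. dist u x < \<delta> \<Longrightarrow> 0 < s \<Longrightarrow> s < \<delta> \<Longrightarrow> f (u + s *\<^sub>R v) \<le> f u + a * s"
  shows "clarke_dderiv f x v \<le> ereal a"
  unfolding clarke_dderiv_def
proof (rule Limsup_bounded)
  have "eventually (\<lambda>u. dist u x < \<delta>) (nhds x)" using assms(1) by (auto simp: eventually_nhds_metric)
  moreover have "eventually (\<lambda>s. 0 < s \<and> s < \<delta>) (at_right (0::real))"
    using assms(1) by (auto simp: eventually_at_right_field)
  moreover have "(f (u + s *\<^sub>R v) - f u) / s \<le> a" if "dist u x < \<delta>" "0 < s" "s < \<delta>" for u s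
    using assms(2)[OF that] that(2) by (simp add: field_simps)
  ultimately show "eventually (\<lambda>p. (case p of (y, \<mu>) \<Rightarrow> ereal ((f (y + \<mu> *\<^sub>R v) - f y) / \<mu>)) \<le> ereal a)
      (nhds x \<times>\<^sub>F at_right 0)"
    unfolding eventually_prod_filter
    by (intro exI[of _ "\<lambda>u. dist u x < \<delta>"] exI[of _ "\<lambda>s. 0 < s \<and> s < \<delta>"]) auto
qed

text \<open>A negative derivative at \<open>l\<close> in direction \<open>v\<close> would give a
  uniform rate of decrease near \<open>l\<close>, hence the same negative bound at
  \<open>y n\<close>, against \<open>\<xi> n\<close> tending to zero in norm.\<close>

lemma critical_point_limit:
  fixes f :: "'a::real_normed_vector \<Rightarrow> real"
  assumes y: "y \<longlonglongrightarrow> l" and \<xi>: "\<And>n. \<xi> n \<in> clarke_gradient f (y n)"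
    and lim: "(\<lambda>n. norm (\<xi> n)) \<longlonglongrightarrow> 0"
  shows "critical_point f l"
proof -
  have "0 \<le> clarke_dderiv f l v" for v
  proof (rule ccontr)
    assume "\<not> ?thesis"
    then obtain a where a: "clarke_dderiv f l v < ereal a" "a < 0"
      using ereal_dense2[of "clarke_dderiv f l v" 0] by (auto simp: not_le)
    obtain \<delta> where \<delta>: "\<delta> > 0"
      "\<And>u s. dist u l < \<delta> \<Longrightarrow> 0 < s \<Longrightarrow> s < \<delta> \<Longrightarrow> f (u + s *\<^sub>R v) < f u + a * s"
      using clarke_dderiv_lessD[OF a(1)] by blast
    have "(\<lambda>n. norm (\<xi> n) * norm v) \<longlonglongrightarrow> 0 * norm v" by (intro tendsto_intros lim)
    then have "eventually (\<lambda>n. norm (\<xi> n) * norm v < - a) sequentially"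
      by (rule order_tendstoD) (use a(2) in simp)
    moreover have "eventually (\<lambda>n. dist (y n) l < \<delta> / 2) sequentially"
      using y \<delta>(1) by (intro tendstoD) auto
    ultimately have "eventually (\<lambda>n. norm (\<xi> n) * norm v < - a \<and> dist (y n) l < \<delta> / 2) sequentially"
      by (rule eventually_conj)
    then obtain n where n: "norm (\<xi> n) * norm v < - a" "dist (y n) l < \<delta> / 2"
      using eventually_happens[of _ sequentially] by auto
    have "clarke_dderiv f (y n) v \<le> ereal a"
    proof (rule clarke_dderiv_leI[of "\<delta> / 2"])
      fix u s assume us: "dist u (y n) < \<delta> / 2" "0 < s" "s < \<delta> / 2"
      then have "dist u l < \<delta>" using n(2) dist_triangle[of u l "y n"] by linarith
      then show "f (u + s *\<^sub>R v) \<le> f u + a * s" using us \<delta> by (intro less_imp_le \<delta>(2)) auto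
    qed (use \<delta> in simp)
    moreover have "ereal (\<xi> n v) \<le> clarke_dderiv f (y n) v" using \<xi> by (simp add: clarke_gradient_def)
    ultimately have "ereal (\<xi> n v) \<le> ereal a" by (rule order_trans[rotated])
    then have "\<xi> n v \<le> a" by simp
    moreover have "\<bar>\<xi> n v\<bar> \<le> norm (\<xi> n) * norm v" using norm_blinfun[of "\<xi> n" v] by simp
    ultimately show False using n(1) by linarith
  qed
  then show ?thesis by (simp add: critical_point_def clarke_gradient_def zero_ereal_def)
qed

text \<open>Contraposition of \<open>clarke_gradient_small_element\<close>: some \<open>v\<close>
  has Clarke derivative below \<open>- \<epsilon> * norm v\<close>, and it remains to normalize
  \<open>v\<close>.\<close>

lemma descent_direction:
  fixes f :: "'a::real_normed_vector \<Rightarrow> real"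
  assumes f: "locally_lipschitz f" and e: "\<epsilon> > 0"
    and no: "\<And>\<xi>. \<xi> \<in> clarke_gradient f x \<Longrightarrow> \<epsilon> < norm \<xi>"
  obtains v \<delta> where "norm v \<le> 1" "\<delta> > 0"
    "\<And>u s. dist u x < \<delta> \<Longrightarrow> 0 < s \<Longrightarrow> s < \<delta> \<Longrightarrow> f (u + s *\<^sub>R v) \<le> f u - \<epsilon> * s"
proof -
  have "\<exists>v. clarke_dderiv f x v < ereal (- \<epsilon> * norm v)"
    using clarke_gradient_small_element[OF f, of \<epsilon> x] e no by (force simp: not_le[symmetric])
  then obtain v where v: "clarke_dderiv f x v < ereal (- \<epsilon> * norm v)" by blast
  obtain \<delta> where \<delta>: "\<delta> > 0" "\<And>u s. dist u x < \<delta> \<Longrightarrow> 0 < s \<Longrightarrow> s < \<delta> \<Longrightarrow>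
      f (u + s *\<^sub>R v) < f u + (- \<epsilon> * norm v) * s"
    using clarke_dderiv_lessD[OF v] by blast
  \<comment> \<open>For \<open>v = 0\<close> the strict inequality would read
    \<open>f x < f x\<close>.\<close>
  have nz: "v \<noteq> 0" using \<delta>(2)[of x "\<delta> / 2"] \<delta>(1) by auto
  show ?thesis
  proof
    show "norm (v /\<^sub>R norm v) \<le> 1" using nz by simp
    \<comment> \<open>A step \<open>s\<close> along the normalized vector is a step
      \<open>s / norm v\<close> along \<open>v\<close>, whence the second bound.\<close>
    show "min \<delta> (\<delta> * norm v) > 0" using \<delta>(1) nz by simp
    fix u s assume us: "dist u x < min \<delta> (\<delta> * norm v)" "0 < s" "s < min \<delta> (\<delta> * norm v)"
    have "f (u + (s / norm v) *\<^sub>R v) < f u + (- \<epsilon> * norm v) * (s / norm v)"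
      using us nz by (intro \<delta>(2)) (auto simp: field_simps)
    also have "(- \<epsilon> * norm v) * (s / norm v) = - (\<epsilon> * s)" using nz by simp
    finally show "f (u + s *\<^sub>R (v /\<^sub>R norm v)) \<le> f u - \<epsilon> * s" by (simp add: divide_inverse)
  qed
qed

text \<open>The directions are followed one after another. Each has norm at most one, so every
  intermediate point stays within \<open>sum t J\<close> of \<open>y\<close>, where descent is
  available. Only indices with positive weight have to offer descent, which suits a partition of
  unity.\<close>

lemma descent_along_combination:
  fixes f :: "'a::real_normed_vector \<Rightarrow> real"
  assumes "finite J" "\<And>i. i \<in> J \<Longrightarrow> 0 \<le> t i" "\<And>i. i \<in> J \<Longrightarrow> norm (v i) \<le> 1" "sum t J < \<delta>"
    and desc: "\<And>i u s. i \<in> J \<Longrightarrow> 0 < t i \<Longrightarrow> norm (u - y) < \<delta> \<Longrightarrow> 0 < s \<Longrightarrow> s < \<delta> \<Longrightarrow>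
      f (u + s *\<^sub>R v i) \<le> f u - \<epsilon> * s"
  shows "f (y + (\<Sum>i\<in>J. t i *\<^sub>R v i)) \<le> f y - \<epsilon> * sum t J"
  using assms
proof (induction J rule: finite_induct)
  case empty then show ?case by simp
next
  case (insert j J)
  have le: "sum t J + t j < \<delta>" "0 \<le> t j" "0 \<le> sum t J"
    using insert.prems insert.hyps by (auto simp: sum_nonneg)
  have IH: "f (y + (\<Sum>i\<in>J. t i *\<^sub>R v i)) \<le> f y - \<epsilon> * sum t J"
  proof (rule insert.IH)
    show "sum t J < \<delta>" using le by linarith
  qed (use insert.prems in auto)
  have "norm (\<Sum>i\<in>J. t i *\<^sub>R v i) \<le> (\<Sum>i\<in>J. norm (t i *\<^sub>R v i))" by (rule norm_sum)
  also have "\<dots> \<le> sum t J"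
    using insert.prems by (intro sum_mono) (auto simp: mult_left_le)
  finally have n: "norm (y + (\<Sum>i\<in>J. t i *\<^sub>R v i) - y) < \<delta>" using le by simp
  have "f (y + (\<Sum>i\<in>J. t i *\<^sub>R v i) + t j *\<^sub>R v j) \<le> f (y + (\<Sum>i\<in>J. t i *\<^sub>R v i)) - \<epsilon> * t j"
  proof (cases "t j = 0")
    case False
    then show ?thesis using le by (intro insert.prems(4) n) auto
  qed simp
  then have "f (y + (\<Sum>i\<in>J. t i *\<^sub>R v i) + t j *\<^sub>R v j) \<le> f y - \<epsilon> * (t j + sum t J)"
    using IH by (simp add: distrib_left)
  then show ?case using insert.hyps by (simp add: add_ac)
qed

subsection \<open>Minimax critical values\<close>

lemma compact_bdd_above_image:
  fixes f :: "'a::topological_space \<Rightarrow> real"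
  shows "compact K \<Longrightarrow> continuous_on K f \<Longrightarrow> bdd_above (f ` K)"
  by (intro bounded_imp_bdd_above compact_imp_bounded compact_continuous_image)

text \<open>Otherwise every maximum point of \<open>f\<close> along \<open>g\<close> has a descent
  direction of rate \<open>2 * \<epsilon>\<close>. Blending these gives a field \<open>w\<close> of
  norm at most one that vanishes on \<open>T\<close>. Moving \<open>g\<close> by
  \<open>\<mu> *\<^sub>R w\<close> lowers the maximum by more than
  \<open>\<epsilon> * \<mu>\<close>, contrary to \<open>mini\<close>.\<close>

lemma almost_critical_point_of_almost_minimizer:
  fixes f :: "'b::real_normed_vector \<Rightarrow> real" and g :: "'a::metric_space \<Rightarrow>\<^sub>C 'b"
  assumes f: "locally_lipschitz f" and K: "compact K" "K \<noteq> {}" and T: "closed T" and e: "\<epsilon> > 0"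
    and low: "\<And>x. x \<in> K \<inter> T \<Longrightarrow> f (g x) < (SUP x\<in>K. f (g x))"
    and mini: "\<And>h. (\<And>x. x \<in> T \<Longrightarrow> apply_bcontfun h x = g x) \<Longrightarrow>
      (SUP x\<in>K. f (g x)) \<le> (SUP x\<in>K. f (h x)) + \<epsilon> * dist g h"
  obtains x \<xi> where "x \<in> K" "f (g x) = (SUP x\<in>K. f (g x))"
    "\<xi> \<in> clarke_gradient f (g x)" "norm \<xi> \<le> 2 * \<epsilon>"
proof (rule ccontr)
  assume neg: "\<not> thesis"
  note goal = that
  define S where "S h = (SUP x\<in>K. f (apply_bcontfun h x))" for h
  have no: "2 * \<epsilon> < norm \<xi>" if "x \<in> K" "f (g x) = S g" "\<xi> \<in> clarke_gradient f (g x)" for x \<xi>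
    using neg goal[of x \<xi>] that unfolding S_def by (meson not_le)
  have cf: "continuous_on UNIV f" by (rule locally_lipschitz_continuous[OF f])
  have cfg: "continuous_on X (\<lambda>x. f (apply_bcontfun h x))" for h :: "'a \<Rightarrow>\<^sub>C 'b" and X
    by (rule continuous_on_compose2[OF cf]) auto
  have upper: "f (apply_bcontfun h x) \<le> S h" if "x \<in> K" for h x
    unfolding S_def by (rule cSUP_upper[OF that compact_bdd_above_image[OF K(1) cfg]])
  have attain: "\<exists>x\<in>K. f (apply_bcontfun h x) = S h" for h
  proof -
    obtain x where x: "x \<in> K" "\<And>y. y \<in> K \<Longrightarrow> f (apply_bcontfun h y) \<le> f (apply_bcontfun h x)"
      using continuous_attains_sup[OF K cfg] by blast
    then have "S h \<le> f (apply_bcontfun h x)" unfolding S_def by (intro cSUP_least K(2)) auto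
    then show ?thesis using x(1) upper[OF x(1), of h] by (intro bexI[of _ x]) auto
  qed
  define M where "M = {x \<in> K. f (g x) = S g}"
  have "M = K \<inter> {x. f (g x) = S g}" by (auto simp: M_def)
  then have cM: "compact M"
    using compact_Int_closed[OF K(1) closed_Collect_eq[OF cfg continuous_on_const]] by simp
  have Mne: "M \<noteq> {}" using attain[of g] by (auto simp: M_def)
  \<comment> \<open>The radius \<open>2 * \<delta>\<close> leaves one \<open>\<delta>\<close> for
    the distance from \<open>g x\<close> to \<open>g y\<close> and one for the move away from
    \<open>g y\<close>.\<close>
  define good where "good x v \<delta> r \<longleftrightarrow> norm v \<le> 1 \<and> \<delta> > 0 \<and> r > 0 \<and>
      (\<forall>y. dist x y < r \<longrightarrow> y \<notin> T \<and> dist (g x) (g y) < \<delta>) \<and>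
      (\<forall>u s. dist u (g x) < 2 * \<delta> \<longrightarrow> 0 < s \<longrightarrow> s < 2 * \<delta> \<longrightarrow> f (u + s *\<^sub>R v) \<le> f u - (2 * \<epsilon>) * s)"
    for x v \<delta> r
  have "\<exists>v \<delta> r. good x v \<delta> r" if x: "x \<in> M" for x
  proof -
    have xK: "x \<in> K" "f (g x) = S g" using x by (auto simp: M_def)
    obtain v \<delta> where v: "norm v \<le> 1" "\<delta> > 0"
      "\<And>u s. dist u (g x) < \<delta> \<Longrightarrow> 0 < s \<Longrightarrow> s < \<delta> \<Longrightarrow> f (u + s *\<^sub>R v) \<le> f u - (2 * \<epsilon>) * s"
      using descent_direction[OF f, of "2 * \<epsilon>" "g x"] e no[OF xK] by (metis mult_pos_pos zero_less_numeral)
    have "x \<notin> T" using low[of x] xK by (auto simp: S_def)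
    then obtain r1 where r1: "r1 > 0" "\<And>y. dist x y < r1 \<Longrightarrow> y \<notin> T"
      using T by (metis ComplD ComplI open_Compl openE mem_ball subsetD)
    have "isCont (apply_bcontfun g) x"
      by (rule continuous_on_interior[OF continuous_on_apply_bcontfun[of UNIV]]) simp
    then obtain r2 where r2: "r2 > 0" "\<And>y. dist x y < r2 \<Longrightarrow> dist (g x) (g y) < \<delta> / 2"
      using v(2) unfolding continuous_at_eps_delta by (metis dist_commute half_gt_zero)
    show ?thesis
      unfolding good_def using v r1 r2 by (intro exI[of _ v] exI[of _ "\<delta> / 2"] exI[of _ "min r1 r2"]) auto
  qed
  then obtain v \<delta> r where good: "\<And>x. x \<in> M \<Longrightarrow> good x (v x) (\<delta> x) (r x)"
    by metis
  then have v: "\<And>x. x \<in> M \<Longrightarrow> norm (v x) \<le> 1" and \<delta>: "\<And>x. x \<in> M \<Longrightarrow> \<delta> x > 0"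
    and r: "\<And>x. x \<in> M \<Longrightarrow> r x > 0" and rT: "\<And>x y. x \<in> M \<Longrightarrow> dist x y < r x \<Longrightarrow> y \<notin> T"
    and rg: "\<And>x y. x \<in> M \<Longrightarrow> dist x y < r x \<Longrightarrow> dist (g x) (g y) < \<delta> x"
    and desc: "\<And>x u s. x \<in> M \<Longrightarrow> dist u (g x) < 2 * \<delta> x \<Longrightarrow> 0 < s \<Longrightarrow> s < 2 * \<delta> x \<Longrightarrow>
      f (u + s *\<^sub>R v x) \<le> f u - (2 * \<epsilon>) * s"
    unfolding good_def by blast+
  obtain D where D: "D \<subseteq> M" "finite D" "M \<subseteq> (\<Union>x\<in>D. ball x (r x))"
    using compactE_image[OF cM, of M "\<lambda>x. ball x (r x)"] r by force
  define \<delta>0 where "\<delta>0 = Min (insert 1 (\<delta> ` D))"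
  have \<delta>0: "\<delta>0 > 0" "\<And>x. x \<in> D \<Longrightarrow> \<delta>0 \<le> \<delta> x"
    using D \<delta> by (auto simp: \<delta>0_def)
  define d where "d x y = max 0 (r x - dist x y)" for x y
  define s where "s y = (\<Sum>x\<in>D. d x y)" for y
  have cs: "continuous_on X s" for X unfolding s_def d_def by (intro continuous_intros)
  have d0: "d x y \<ge> 0" for x y by (simp add: d_def)
  have s0: "s y \<ge> 0" for y unfolding s_def by (intro sum_nonneg d0)
  have sM: "s y > 0" if "y \<in> M" for y
  proof -
    obtain x where "x \<in> D" "dist x y < r x" using D(3) \<open>y \<in> M\<close> by auto
    then show ?thesis unfolding s_def using D(2) d0 by (intro sum_pos2[of D x]) (auto simp: d_def)
  qed
  obtain \<sigma> where \<sigma>: "\<sigma> > 0" "\<And>y. y \<in> M \<Longrightarrow> \<sigma> \<le> s y"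
    using continuous_attains_inf[OF cM Mne cs] sM by blast
  txt \<open>The \<open>\<kappa> x\<close> are a partition of unity on \<open>M\<close>; the cutoff \<open>\<sigma>\<close> keeps them continuous, with sum
    \<open>\<tau> \<le> 1\<close>, everywhere.\<close>
  define \<kappa> where "\<kappa> x y = d x y / max \<sigma> (s y)" for x y
  define \<tau> where "\<tau> y = (\<Sum>x\<in>D. \<kappa> x y)" for y
  define w where "w y = (\<Sum>x\<in>D. \<kappa> x y *\<^sub>R v x)" for y
  have mx: "max \<sigma> (s y) > 0" for y using \<sigma>(1) by (simp add: less_max_iff_disj)
  have \<kappa>0: "\<kappa> x y \<ge> 0" for x y using d0 mx[of y] by (simp add: \<kappa>_def)
  have \<tau>: "\<tau> y = s y / max \<sigma> (s y)" for y by (simp add: \<tau>_def \<kappa>_def s_def sum_divide_distrib)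
  have \<tau>0: "0 \<le> \<tau> y" "\<tau> y \<le> 1" for y using s0[of y] mx[of y] by (auto simp: \<tau>)
  have \<tau>M: "\<tau> y = 1" if "y \<in> M" for y using \<sigma>(2)[OF that] mx[of y] by (simp add: \<tau> max_absorb2)
  have c\<kappa>: "continuous_on X (\<kappa> x)" for X x
    unfolding \<kappa>_def d_def by (intro continuous_intros cs) (use mx in \<open>metis less_irrefl\<close>)
  have c\<tau>: "continuous_on X \<tau>" for X unfolding \<tau>_def by (intro continuous_intros c\<kappa>)
  have cw: "continuous_on X w" for X unfolding w_def by (intro continuous_intros c\<kappa>)
  have nw: "norm (w y) \<le> 1" for y
  proof -
    have "norm (w y) \<le> (\<Sum>x\<in>D. norm (\<kappa> x y *\<^sub>R v x))" unfolding w_def by (rule norm_sum)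
    also have "\<dots> \<le> \<tau> y"
      unfolding \<tau>_def using v D(1) \<kappa>0 by (intro sum_mono) (auto simp: mult_left_le)
    finally show ?thesis using \<tau>0(2)[of y] by linarith
  qed
  have wT: "w y = 0" if "y \<in> T" for y
  proof -
    have "\<kappa> x y = 0" if "x \<in> D" for x
    proof -
      have "\<not> dist x y < r x" using rT[of x y] D(1) \<open>y \<in> T\<close> that by blast
      then show ?thesis by (simp add: \<kappa>_def d_def)
    qed
    then show ?thesis by (simp add: w_def)
  qed
  have drop: "f (g y + \<mu> *\<^sub>R w y) \<le> f (g y) - (2 * \<epsilon>) * (\<mu> * \<tau> y)" if \<mu>: "0 < \<mu>" "\<mu> < \<delta>0" for \<mu> y
  proof -
    have "f (g y + (\<Sum>x\<in>D. (\<mu> * \<kappa> x y) *\<^sub>R v x)) \<le> f (g y) - (2 * \<epsilon>) * (\<Sum>x\<in>D. \<mu> * \<kappa> x y)"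
    proof (rule descent_along_combination[OF D(2), where \<delta> = \<delta>0])
      show "0 \<le> \<mu> * \<kappa> x y" for x using \<mu> \<kappa>0 by simp
      show "norm (v x) \<le> 1" if "x \<in> D" for x using v D(1) that by blast
      have "(\<Sum>x\<in>D. \<mu> * \<kappa> x y) = \<mu> * \<tau> y" by (simp add: \<tau>_def sum_distrib_left)
      also have "\<dots> \<le> \<mu>" using \<mu> \<tau>0 by (simp add: mult_left_le)
      finally show "(\<Sum>x\<in>D. \<mu> * \<kappa> x y) < \<delta>0" using \<mu> by simp
      fix x u s
      assume x: "x \<in> D" "0 < \<mu> * \<kappa> x y" and u: "norm (u - g y) < \<delta>0" and s: "0 < s" "s < \<delta>0"
      have "d x y \<noteq> 0" using x(2) by (auto simp: \<kappa>_def)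
      then have "dist x y < r x" by (auto simp: d_def max_def split: if_splits)
      then have "dist (g x) (g y) < \<delta> x" using x(1) D(1) by (intro rg) auto
      then have "dist u (g x) < 2 * \<delta> x"
        using u \<delta>0(2)[OF x(1)] dist_triangle2[of u "g x" "g y"] by (simp add: dist_norm)
      then show "f (u + s *\<^sub>R v x) \<le> f u - (2 * \<epsilon>) * s"
        using s \<delta>0(1) \<delta>0(2)[OF x(1)] x(1) D(1) by (intro desc) auto
    qed
    then show ?thesis by (simp add: w_def \<tau>_def scaleR_sum_right sum_distrib_left)
  qed
  \<comment> \<open>Since \<open>\<tau>\<close> is one on \<open>M\<close>, the set where
    \<open>\<tau>\<close> is at most one half misses the maximum points, and compactness gives a gap
    \<open>\<eta>\<close>.\<close>
  obtain \<eta> where \<eta>: "\<eta> > 0" "\<And>y. y \<in> K \<Longrightarrow> \<tau> y \<le> 1 / 2 \<Longrightarrow> f (g y) \<le> S g - \<eta>"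
  proof (cases "\<exists>y\<in>K. \<tau> y \<le> 1 / 2")
    case False then show ?thesis using that[of 1] by auto
  next
    case True
    have "compact (K \<inter> {y. \<tau> y \<le> 1 / 2})"
      by (intro compact_Int_closed K closed_Collect_le c\<tau> continuous_on_const)
    then obtain y where y: "y \<in> K" "\<tau> y \<le> 1 / 2"
      "\<And>y'. y' \<in> K \<Longrightarrow> \<tau> y' \<le> 1 / 2 \<Longrightarrow> f (g y') \<le> f (g y)"
      using continuous_attains_sup[OF _ _ cfg, of "K \<inter> {y. \<tau> y \<le> 1 / 2}" g] True by auto
    have "y \<notin> M" using \<tau>M[of y] y(2) by auto
    then have "f (g y) < S g" using upper[OF y(1), of g] y(1) by (auto simp: M_def)
    then show ?thesis using that[of "S g - f (g y)"] y(3) by auto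
  qed
  \<comment> \<open>The first bound keeps the move within the descent radius; the second makes the
    admissible loss \<open>\<epsilon> * \<mu>\<close> at most half the gap.\<close>
  define \<mu> where "\<mu> = min (\<delta>0 / 2) (\<eta> / (2 * \<epsilon>))"
  have \<mu>: "0 < \<mu>" "\<mu> < \<delta>0" using \<delta>0(1) \<eta>(1) e by (auto simp: \<mu>_def)
  have "\<mu> \<le> \<eta> / (2 * \<epsilon>)" by (simp add: \<mu>_def)
  then have \<mu>\<eta>: "\<epsilon> * \<mu> \<le> \<eta> / 2" using e by (simp add: field_simps)
  have "w \<in> bcontfun" using cw nw by (rule bcontfun_normI)
  then have wapp: "apply_bcontfun (Bcontfun w) = w" by (simp add: Bcontfun_inverse)
  define h where "h = g + \<mu> *\<^sub>R Bcontfun w"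
  have happ: "apply_bcontfun h y = g y + \<mu> *\<^sub>R w y" for y by (simp add: h_def plus_bcontfun.rep_eq scaleR_bcontfun.rep_eq wapp)
  have "norm (Bcontfun w) \<le> 1" by (rule norm_bound) (simp add: wapp nw)
  then have "dist g h \<le> \<mu>" using \<mu>(1) by (simp add: h_def dist_norm mult_left_le)
  moreover have "S g \<le> S h + \<epsilon> * dist g h"
    using mini[of h] wT happ by (simp add: S_def)
  ultimately have Sgh: "S g \<le> S h + \<epsilon> * \<mu>" using e mult_left_mono[of "dist g h" \<mu> \<epsilon>] by linarith
  obtain y where y: "y \<in> K" "f (apply_bcontfun h y) = S h" using attain by blast
  \<comment> \<open>At a maximum point \<open>y\<close> of the perturbed map,
    \<open>\<tau> y > 1 / 2\<close> would mean too large a drop, while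
    \<open>\<tau> y \<le> 1 / 2\<close> runs into the gap \<open>\<eta>\<close>.\<close>
  have *: "S g \<le> f (g y) - 2 * (\<epsilon> * \<mu>) * \<tau> y + \<epsilon> * \<mu>"
    using drop[OF \<mu>, of y] Sgh y(2) by (simp add: happ mult_ac)
  then have "(\<epsilon> * \<mu>) * (2 * \<tau> y) \<le> (\<epsilon> * \<mu>) * 1" using upper[OF y(1), of g] by simp
  then have "\<tau> y \<le> 1 / 2" using e \<mu>(1) by (simp add: mult_le_cancel_left)
  then have "f (g y) \<le> S g - \<eta>" using \<eta>(2) y(1) by blast
  moreover have "0 \<le> 2 * (\<epsilon> * \<mu>) * \<tau> y" using e \<mu>(1) \<tau>0(1) by simp
  ultimately show False using * \<mu>\<eta> \<eta>(1) by linarith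
qed

text \<open>Ekeland's principle is applied with \<open>\<epsilon> = 1 / (n + 1)\<close> to the
  maximum of \<open>f\<close> over \<open>K\<close>, on the complete set \<open>G\<close> of maps
  with prescribed values on \<open>T\<close>. The almost critical points found have levels tending
  to \<open>c\<close>.\<close>

theorem minimax_critical_value:
  fixes f :: "'b::banach \<Rightarrow> real" and g0 :: "'a::metric_space \<Rightarrow>\<^sub>C 'b"
  assumes f: "locally_lipschitz f" and K: "compact K" "K \<noteq> {}" and T: "closed T"
    and low: "\<And>x. x \<in> K \<inter> T \<Longrightarrow> f (g0 x) < c"
    and lower: "\<And>g. (\<And>x. x \<in> T \<Longrightarrow> apply_bcontfun g x = g0 x) \<Longrightarrow> c \<le> (SUP x\<in>K. f (g x))"
    and approx: "\<And>e. e > 0 \<Longrightarrow>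
      \<exists>g. (\<forall>x\<in>T. apply_bcontfun g x = g0 x) \<and> (SUP x\<in>K. f (g x)) < c + e"
    and PS: "palais_smale f c"
  shows "critical_value f c"
proof -
  define G where "G = {g. \<forall>x\<in>T. apply_bcontfun g x = g0 x}"
  define S where "S h = (SUP x\<in>K. f (apply_bcontfun h x))" for h
  have cf: "continuous_on UNIV f" by (rule locally_lipschitz_continuous[OF f])
  have cfg: "continuous_on X (\<lambda>x. f (apply_bcontfun h x))" for h :: "'a \<Rightarrow>\<^sub>C 'b" and X
    by (rule continuous_on_compose2[OF cf]) auto
  have upper: "f (apply_bcontfun h x) \<le> S h" if "x \<in> K" for h x
    unfolding S_def by (rule cSUP_upper[OF that compact_bdd_above_image[OF K(1) cfg]])
  have eval_lim: "(\<lambda>n. apply_bcontfun (h n) x) \<longlonglongrightarrow> apply_bcontfun l x" if "h \<longlonglongrightarrow> l" for h l and x :: 'a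
    using that unfolding tendsto_dist_iff[of h] tendsto_dist_iff[of "\<lambda>n. apply_bcontfun (h n) x"]
    by (rule tendsto_sandwich[OF _ _ tendsto_const, rotated 2]) (auto simp: dist_bounded)
  have "closed G"
    unfolding closed_sequential_limits
  proof (intro allI impI, elim conjE)
    fix h l assume h: "\<forall>n. h n \<in> G" "h \<longlonglongrightarrow> l"
    have "apply_bcontfun l x = g0 x" if "x \<in> T" for x
      using LIMSEQ_unique[OF eval_lim[OF h(2), of x]] h(1) that by (auto simp: G_def)
    then show "l \<in> G" by (simp add: G_def)
  qed
  then have cG: "complete G" by (simp add: complete_eq_closed)
  have "\<exists>y \<xi>. c \<le> f y \<and> f y \<le> c + inverse (real (Suc n)) \<and> \<xi> \<in> clarke_gradient f y \<and>
      norm \<xi> \<le> 2 * inverse (real (Suc n))" for n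
  proof -
    define e where "e = inverse (real (Suc n))"
    have e: "e > 0" by (simp add: e_def)
    obtain g1 where g1: "g1 \<in> G" "S g1 < c + e" using approx[OF e] by (auto simp: G_def S_def)
    obtain g where g: "g \<in> G" "S g \<le> S g1" "\<And>h. h \<in> G \<Longrightarrow> S g \<le> S h + e * dist g h"
    proof (rule ekeland[OF cG g1(1), of c S e])
      show "c \<le> S h" if "h \<in> G" for h using that lower[of h] by (simp add: G_def S_def)
      \<comment> \<open>A supremum of functions of the map that are continuous under uniform
        convergence is lower semicontinuous.\<close>
      show "S l \<le> b" if "\<And>n. h n \<in> G" "h \<longlonglongrightarrow> l" "\<And>n. S (h n) \<le> b" for h l b
        unfolding S_def
      proof (rule cSUP_least[OF K(2)])
        fix x assume x: "x \<in> K"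
        have "isCont f (apply_bcontfun l x)" using cf by (simp add: continuous_on_eq_continuous_at)
        then have "(\<lambda>n. f (apply_bcontfun (h n) x)) \<longlonglongrightarrow> f (apply_bcontfun l x)"
          using eval_lim[OF that(2)] by (rule isCont_tendsto_compose)
        then show "f (apply_bcontfun l x) \<le> b"
          by (rule LIMSEQ_le_const2) (use upper[OF x] that(3) order_trans in blast)
      qed
    qed (use e in auto)
    have cg: "c \<le> S g" using g(1) lower[of g] by (simp add: G_def S_def)
    obtain x \<xi> where "x \<in> K" "f (g x) = S g" "\<xi> \<in> clarke_gradient f (g x)" "norm \<xi> \<le> 2 * e"
    proof (rule almost_critical_point_of_almost_minimizer[OF f K T e, of g])
      \<comment> \<open>On \<open>T\<close> the map agrees with \<open>g0\<close>, whose values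
        there lie below \<open>c\<close>, and \<open>c\<close> is at most the maximum.\<close>
      show "f (g x) < (SUP x\<in>K. f (g x))" if "x \<in> K \<inter> T" for x
        using low[OF that] cg g(1) that by (simp add: G_def S_def)
      show "(SUP x\<in>K. f (g x)) \<le> (SUP x\<in>K. f (apply_bcontfun h x)) + e * dist g h"
        if "\<And>x. x \<in> T \<Longrightarrow> apply_bcontfun h x = g x" for h
        using g(3)[of h] g(1) that by (simp add: G_def S_def)
    qed (auto simp: S_def)
    then show ?thesis using cg g(2) g1(2) unfolding e_def
      by (intro exI[of _ "apply_bcontfun g x"] exI[of _ \<xi>]) simp
  qed
  then obtain y \<xi> where y: "\<And>n. c \<le> f (y n)" "\<And>n. f (y n) \<le> c + inverse (real (Suc n))"
    and \<xi>: "\<And>n. \<xi> n \<in> clarke_gradient f (y n)" "\<And>n. norm (\<xi> n) \<le> 2 * inverse (real (Suc n))"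
    by metis
  have lim1: "(\<lambda>n. c + inverse (real (Suc n))) \<longlonglongrightarrow> c"
    using tendsto_add[OF tendsto_const LIMSEQ_inverse_real_of_nat, of c] by simp
  have lim2: "(\<lambda>n. 2 * inverse (real (Suc n))) \<longlonglongrightarrow> 0"
    using tendsto_mult[OF tendsto_const LIMSEQ_inverse_real_of_nat, of 2] by simp
  have fy: "(\<lambda>n. f (y n)) \<longlonglongrightarrow> c"
    by (rule tendsto_sandwich[OF _ _ tendsto_const lim1]) (use y in auto)
  have n\<xi>: "(\<lambda>n. norm (\<xi> n)) \<longlonglongrightarrow> 0"
    by (rule tendsto_sandwich[OF _ _ tendsto_const lim2]) (use \<xi>(2) in auto)
  have ms: "0 \<le> min_slope f (y n)" "min_slope f (y n) \<le> norm (\<xi> n)" for n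
    unfolding min_slope_def using \<xi>(1)[of n]
    by (intro cINF_greatest cINF_lower bdd_belowI2[of _ 0]; force)+
  have "(\<lambda>n. min_slope f (y n)) \<longlonglongrightarrow> 0"
    by (rule tendsto_sandwich[OF _ _ tendsto_const n\<xi>]) (use ms in auto)
  then obtain r l where r: "strict_mono (r :: nat \<Rightarrow> nat)" and l: "(y \<circ> r) \<longlonglongrightarrow> l"
    using PS fy unfolding palais_smale_def by blast
  have "critical_point f l"
    by (rule critical_point_limit[OF l, of "\<xi> \<circ> r"])
       (use \<xi>(1) LIMSEQ_subseq_LIMSEQ[OF n\<xi> r] in \<open>auto simp: o_def\<close>)
  moreover have "isCont f l" using cf by (simp add: continuous_on_eq_continuous_at)
  then have "(\<lambda>n. f ((y \<circ> r) n)) \<longlonglongrightarrow> f l" using l by (rule isCont_tendsto_compose)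
  then have "f l = c" using LIMSEQ_unique LIMSEQ_subseq_LIMSEQ[OF fy r] by (auto simp: o_def)
  ultimately show ?thesis unfolding critical_value_def by blast
qed

subsection \<open>Splittings with a finite-dimensional summand\<close>

text \<open>The unit sphere of \<open>X2\<close> is compact and misses \<open>closure X1\<close>, so
  its distance \<open>m\<close> to \<open>X1\<close> is positive. Hence
  \<open>m * norm x2 \<le> norm (x1 + x2)\<close>, and the algebraic projection is
  Lipschitz.\<close>

lemma continuous_projection:
  fixes X1 X2 :: "'a::real_normed_vector set"
  assumes ds: "direct_sum_decomposition X1 X2" and fd: "finite_dimensional_subspace X2"
    and triv: "closure X1 \<inter> X2 \<subseteq> {0}"
  obtains P where "continuous_on UNIV P" "\<And>x. P x \<in> X2" "\<And>x. x - P x \<in> X1" "\<And>x. x \<in> X2 \<Longrightarrow> P x = x"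
proof -
  have sub1: "subspace X1" and sub2: "subspace X2" and int: "X1 \<inter> X2 = {0}"
    and dec: "\<And>x. \<exists>x1\<in>X1. \<exists>x2\<in>X2. x = x1 + x2"
    using ds by (auto simp: direct_sum_decomposition_def)
  define U where "U = {w \<in> X2. norm w = 1}"
  have "U = {w \<in> X2. norm w \<le> 1} \<inter> {w. norm w = 1}" by (auto simp: U_def)
  moreover have "closed {w::'a. norm w = 1}" by (intro closed_Collect_eq continuous_intros)
  ultimately have cU: "compact U"
    using compact_Int_closed[OF compact_finite_dimensional_cball[OF fd, of 1]] by simp
  have ne1: "X1 \<noteq> {}" using subspace_0[OF sub1] by blast
  obtain m where m: "m > 0" "\<And>w. w \<in> U \<Longrightarrow> m \<le> infdist w X1"
  proof (cases "U = {}")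
    case True then show ?thesis using that[of 1] by simp
  next
    case False
    obtain w where w: "w \<in> U" "\<And>w'. w' \<in> U \<Longrightarrow> infdist w X1 \<le> infdist w' X1"
      using continuous_attains_inf[OF cU False, of "\<lambda>w. infdist w X1"]
        continuous_on_infdist[OF continuous_on_id, of U X1] by auto
    have "w \<notin> closure X1" using w(1) triv by (auto simp: U_def)
    then have "infdist w X1 > 0"
      using in_closure_iff_infdist_zero[OF ne1, of w] infdist_nonneg[of w X1] by simp
    then show ?thesis using that w(2) by blast
  qed
  have lower: "m * norm x2 \<le> norm (x1 + x2)" if "x1 \<in> X1" "x2 \<in> X2" for x1 x2
  proof (cases "x2 = 0")
    case False
    have "x2 /\<^sub>R norm x2 \<in> U" using False that(2) sub2 by (simp add: U_def subspace_scale)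
    then have "m \<le> infdist (x2 /\<^sub>R norm x2) X1" by (rule m)
    \<comment> \<open>This point of \<open>X1\<close> turns the distance into the norm of the scaled
      sum \<open>x1 + x2\<close>.\<close>
    also have "- (x1 /\<^sub>R norm x2) \<in> X1" using that(1) sub1 by (simp add: subspace_scale subspace_neg)
    then have "infdist (x2 /\<^sub>R norm x2) X1 \<le> dist (x2 /\<^sub>R norm x2) (- (x1 /\<^sub>R norm x2))"
      by (rule infdist_le)
    also have "\<dots> = norm (x1 + x2) / norm x2"
      by (simp add: dist_norm scaleR_add_right[symmetric] add.commute divide_inverse_commute)
    finally show ?thesis using False by (simp add: field_simps)
  qed simp
  have "\<exists>p. p \<in> X2 \<and> x - p \<in> X1" for x using dec[of x] by force
  then obtain P where P: "\<And>x. P x \<in> X2" "\<And>x. x - P x \<in> X1" by metis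
  show ?thesis
  proof
    have "(1 / m)-lipschitz_on UNIV P"
    proof (rule lipschitz_onI)
      fix x y
      have "(x - P x) - (y - P y) \<in> X1" "P x - P y \<in> X2" using P sub1 sub2 by (simp_all add: subspace_diff)
      then have "m * norm (P x - P y) \<le> norm (((x - P x) - (y - P y)) + (P x - P y))" by (rule lower)
      then show "dist (P x) (P y) \<le> 1 / m * dist x y" using m(1) by (simp add: dist_norm field_simps)
    qed (use m in simp)
    then show "continuous_on UNIV P" by (rule lipschitz_on_continuous_on)
    fix x
    show "P x \<in> X2" "x - P x \<in> X1" by (rule P)+
    assume "x \<in> X2"
    then have "x - P x \<in> X1 \<inter> X2" using P[of x] sub2 by (simp add: subspace_diff)
    then show "P x = x" using int by simp
  qed
qed

section \<open>Saddle point geometry and extension of the admissible maps from the ball to the whole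
  space\<close>

theorem corollary8:
  fixes f :: "'a::banach \<Rightarrow> real"
    and X1 X2 K Kstar :: "'a set"
    and z :: 'a
    and R c :: real
  assumes "locally_lipschitz f"
    and "direct_sum_decomposition X1 X2"
    and "finite_dimensional_subspace X2"
    and "z \<in> X2"
    and "R > norm z"
    and "Kstar = {x \<in> X2. norm x = R}"
    and "(INF x\<in>X1. ereal (f (x + z))) > (SUP x\<in>Kstar. ereal (f x))"
    and "K = {x \<in> X2. norm x \<le> R}"
    and "c = (INF p\<in>fixed_sphere_maps K R. SUP x\<in>K. f (p x))"
    and "palais_smale f c"
  shows "critical_value f c"
proof -
  note f = assms(1) and fd = assms(3) and z = assms(4,5) and Ks = assms(6) and K = assms(8) and c = assms(9)
  have sub1: "subspace X1" and sub2: "subspace X2"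
    using assms(2) by (auto simp: direct_sum_decomposition_def)
  have R: "R > 0" using z(2) norm_ge_zero[of z] by linarith
  have cf: "continuous_on UNIV f" by (rule locally_lipschitz_continuous[OF f])
  \<comment> \<open>Two separating levels \<open>a < b\<close> are kept, since passing to the
    closure preserves only a weak inequality.\<close>
  obtain a where a: "(SUP x\<in>Kstar. ereal (f x)) < ereal a" "ereal a < (INF x\<in>X1. ereal (f (x + z)))"
    using ereal_dense2[OF assms(7)] by blast
  obtain b where ab: "ereal a < ereal b" and b: "ereal b < (INF x\<in>X1. ereal (f (x + z)))"
    using ereal_dense2[OF a(2)] by blast
  have fa: "f x \<le> a" if "x \<in> Kstar" for x
    using SUP_upper[OF that, of "\<lambda>x. ereal (f x)"] a(1) by (metis ereal_less_eq(3) less_imp_le order_trans)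
  have fb: "b \<le> f (x + z)" if "x \<in> X1" for x
    using INF_lower[OF that, of "\<lambda>x. ereal (f (x + z))"] b by (metis ereal_less_eq(3) less_imp_le order_trans)
  have "closure X1 \<inter> X2 \<subseteq> {0}"
  proof
    fix w assume w: "w \<in> closure X1 \<inter> X2"
    show "w \<in> {0}"
    proof (rule ccontr)
      assume "w \<notin> {0}"
      then have w0: "norm w > 0" by simp
      \<comment> \<open>Then \<open>z + T *\<^sub>R w\<close> has norm at least
        \<open>2 * R - norm z > R\<close>, so the segment from \<open>z\<close> crosses the
        sphere.\<close>
      define T where "T = 2 * R / norm w"
      have "norm (T *\<^sub>R w) = 2 * R" using w0 R by (simp add: T_def)
      then have "R \<le> norm (z + T *\<^sub>R w)" using norm_diff_ineq[of "T *\<^sub>R w" z] z(2) by (simp add: add.commute)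
      moreover have "T \<ge> 0" using R w0 by (simp add: T_def)
      moreover have "continuous_on {0..T} (\<lambda>t. norm (z + t *\<^sub>R w))" by (intro continuous_intros)
      moreover have "norm (z + 0 *\<^sub>R w) \<le> R" using z(2) by simp
      ultimately obtain t where t: "norm (z + t *\<^sub>R w) = R"
        using IVT'[of "\<lambda>t. norm (z + t *\<^sub>R w)" 0 R T] by blast
      then have "z + t *\<^sub>R w \<in> Kstar" using w z(1) sub2 by (simp add: Ks subspace_add subspace_scale)
      then have "f (z + t *\<^sub>R w) \<le> a" by (rule fa)
      \<comment> \<open>By continuity of \<open>f\<close> the lower bound on \<open>X1 + z\<close>
        reaches the crossing point.\<close>
      moreover have "closure X1 \<subseteq> {x. b \<le> f (t *\<^sub>R x + z)}"
      proof (rule closure_minimal)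
        show "X1 \<subseteq> {x. b \<le> f (t *\<^sub>R x + z)}" using fb sub1 by (auto simp: subspace_scale)
        show "closed {x. b \<le> f (t *\<^sub>R x + z)}"
        proof (rule closed_Collect_le[OF continuous_on_const])
          show "continuous_on UNIV (\<lambda>x. f (t *\<^sub>R x + z))"
            by (rule continuous_on_compose2[OF cf]) (intro continuous_intros, simp)
        qed
      qed
      then have "b \<le> f (z + t *\<^sub>R w)" using w by (auto simp: add.commute)
      ultimately show False using ab by simp
    qed
  qed
  from continuous_projection[OF assms(2,3) this]
  obtain P where P: "continuous_on UNIV P" "\<And>x. P x \<in> X2" "\<And>x. x - P x \<in> X1"
    "\<And>x. x \<in> X2 \<Longrightarrow> P x = x"
    by blast
  have cK: "compact K" unfolding K by (rule compact_finite_dimensional_cball[OF fd])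
  have Kne: "K \<noteq> {}" using z by (auto simp: K)
  have KsK: "Kstar = K \<inter> {x. norm x = R}" by (auto simp: Ks K)
  have "closed {x::'a. norm x = R}" by (intro closed_Collect_eq continuous_intros)
  then have Kscl: "closed Kstar" unfolding KsK by (intro closed_Int compact_imp_closed[OF cK])
  have upper: "f (p x) \<le> (SUP x\<in>K. f (p x))" if "continuous_on K p" "x \<in> K" for p x
    by (rule cSUP_upper[OF that(2)], rule compact_bdd_above_image[OF cK], rule continuous_on_compose2[OF cf that(1)]) auto
  \<comment> \<open>The map \<open>P\<close> after \<open>p\<close> fixes the sphere, so it takes
    the value \<open>z\<close> at some \<open>x\<close>; then \<open>p x - z\<close> lies in
    \<open>X1\<close>.\<close>
  have link: "b \<le> (SUP x\<in>K. f (p x))" if p: "p \<in> fixed_sphere_maps K R" for p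
  proof -
    have cp: "continuous_on K p" and bd: "\<And>x. x \<in> Kstar \<Longrightarrow> p x = x"
      using p by (auto simp: fixed_sphere_maps_def KsK)
    have "\<exists>x\<in>X2. norm x \<le> R \<and> P (p x) = z"
    proof (rule finite_dimensional_linking[OF fd z])
      show "continuous_on {x \<in> X2. norm x \<le> R} (\<lambda>x. P (p x))"
        using continuous_on_compose2[OF P(1) cp] by (simp add: K)
    qed (use P bd Ks in auto)
    then obtain x where x: "x \<in> K" "P (p x) = z" by (auto simp: K)
    then have "b \<le> f (p x)" using fb[OF P(3)[of "p x"]] by simp
    then show ?thesis using upper[OF cp x(1)] by simp
  qed
  have idF: "(\<lambda>x. x) \<in> fixed_sphere_maps K R" by (simp add: fixed_sphere_maps_def)
  have bdd: "bdd_below ((\<lambda>p. SUP x\<in>K. f (p x)) ` fixed_sphere_maps K R)"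
    using link by (rule bdd_belowI2)
  have cb: "b \<le> c" unfolding c using idF link by (intro cINF_greatest) auto
  \<comment> \<open>A retraction of the whole space onto \<open>K\<close>: projection to
    \<open>X2\<close> followed by radial truncation. Precomposing with it makes an admissible map
    bounded and continuous everywhere without changing it on \<open>K\<close>.\<close>
  define \<rho> where "\<rho> x = (R / max R (norm (P x))) *\<^sub>R P x" for x
  have mx: "max R (norm (P x)) > 0" for x using R by (simp add: less_max_iff_disj)
  have c\<rho>: "continuous_on UNIV \<rho>"
    unfolding \<rho>_def using mx by (intro continuous_intros P(1)) (metis less_irrefl)
  have \<rho>K: "\<rho> x \<in> K" for x
  proof -
    have "norm (\<rho> x) = R * norm (P x) / max R (norm (P x))" using R mx[of x] by (simp add: \<rho>_def)
    also have "\<dots> \<le> R" using R mx[of x] by (simp add: field_simps)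
    finally show ?thesis using P(2) sub2 by (simp add: K \<rho>_def subspace_scale)
  qed
  have \<rho>id: "\<rho> x = x" if "x \<in> K" for x
    using that P(4)[of x] R by (simp add: K \<rho>_def max_absorb1)
  have ext: "apply_bcontfun (Bcontfun (\<lambda>x. p (\<rho> x))) = (\<lambda>x. p (\<rho> x))" if "continuous_on K p" for p :: "'a \<Rightarrow> 'a"
  proof (rule Bcontfun_inverse)
    have "bounded (p ` K)" using compact_continuous_image[OF that cK] by (rule compact_imp_bounded)
    then obtain B where B: "\<And>x. x \<in> K \<Longrightarrow> norm (p x) \<le> B" unfolding bounded_iff by blast
    show "(\<lambda>x. p (\<rho> x)) \<in> bcontfun"
    proof (rule bcontfun_normI)
      show "continuous_on UNIV (\<lambda>x. p (\<rho> x))" using continuous_on_compose2[OF that c\<rho>] \<rho>K by blast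
    qed (use B \<rho>K in blast)
  qed
  define g0 where "g0 = Bcontfun (\<lambda>x. \<rho> x)"
  have g0: "apply_bcontfun g0 x = x" if "x \<in> Kstar" for x
    using ext[of "\<lambda>x. x"] \<rho>id that by (simp add: g0_def KsK)
  show ?thesis
  proof (rule minimax_critical_value[OF f cK Kne Kscl, of g0])
    \<comment> \<open>On the sphere \<open>g0\<close> is the identity, so the values are at most
      \<open>a < b \<le> c\<close>.\<close>
    show "f (apply_bcontfun g0 x) < c" if "x \<in> K \<inter> Kstar" for x
      using fa[of x] g0[of x] that ab cb by auto
    show "c \<le> (SUP x\<in>K. f (apply_bcontfun g x))"
      if "\<And>x. x \<in> Kstar \<Longrightarrow> apply_bcontfun g x = apply_bcontfun g0 x" for g
    proof -
      have "apply_bcontfun g \<in> fixed_sphere_maps K R" using that g0 by (simp add: fixed_sphere_maps_def KsK)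
      then show ?thesis unfolding c by (rule cINF_lower[OF bdd])
    qed
    show "\<exists>g. (\<forall>x\<in>Kstar. apply_bcontfun g x = apply_bcontfun g0 x) \<and> (SUP x\<in>K. f (apply_bcontfun g x)) < c + e"
      if "e > 0" for e
    proof -
      have "(INF p\<in>fixed_sphere_maps K R. SUP x\<in>K. f (p x)) < c + e" using that c by simp
      then obtain p where p: "p \<in> fixed_sphere_maps K R" "(SUP x\<in>K. f (p x)) < c + e"
        using cINF_less_iff[OF _ bdd] idF by blast
      have cp: "continuous_on K p" using p by (simp add: fixed_sphere_maps_def)
      have "(SUP x\<in>K. f (p (\<rho> x))) = (SUP x\<in>K. f (p x))" using \<rho>id by (intro SUP_cong) auto
      then show ?thesis
        using p g0 ext[OF cp] \<rho>id
        by (intro exI[of _ "Bcontfun (\<lambda>x. p (\<rho> x))"]) (auto simp: fixed_sphere_maps_def KsK)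
    qed
  qed (rule assms(10))
qed

end
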